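(* For every constant $\delta>0$ there is a threshold $n_0=n_0(\delta)$ such that the following holds. Let $A,B,C$ be mutually avoiding $n$-element pointsets in the plane, and suppose that there are at least $\delta n^2$ collinear triples $(a,b,c)$ with $a\in A$, $b\in B$, $c\in C$. If $n\geq n_0$, then some six of these collinear triples form a tic-tac-toe configuration.
   Context: Three finite pointsets $P,Q,S$ in the plane are mutually avoiding if no line determined by two points of one of the sets intersects the convex hulls of the other two sets. A collinear triple $(a,b,c)$ is an ordered triple with $a\in A$, $b\in B$, $c\in C$ whose three points lie on a common line; such triples are viewed as the edges of a 3-uniform hypergraph on $A\cup B\cup C$. Six edges form a tic-tac-toe if there are nine distinct vertices $x_{ij}$ ($1\le i,j\le 3$) such that the six edges are exactly the three "rows" $\{x_{i1},x_{i2},x_{i3}\}$ ($i=1,2,3$) and the three "columns" $\{x_{1j},x_{2j},x_{3j}\}$ ($j=1,2,3$), i.e. they intersect each other like the rows and columns of a $3\times 3$ tic-tac-toe board. *)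

theory Defs
  imports "HOL-Analysis.Analysis"
begin

definition avoids :: "(real^2) set \<Rightarrow> (real^2) set \<Rightarrow> bool" where
  "avoids P Q \<longleftrightarrow>
     (\<forall>p\<in>P. \<forall>q\<in>P. p \<noteq> q \<longrightarrow> affine hull {p, q} \<inter> convex hull Q = {})"

text \<open>A line spanned by one of the sets may meet neither of the other two hulls. For sets with
  at least two points each this makes the three sets pairwise disjoint.\<close>

definition mutually_avoiding :: "(real^2) set \<Rightarrow> (real^2) set \<Rightarrow> (real^2) set \<Rightarrow> bool" where
  "mutually_avoiding P Q S \<longleftrightarrow>
     finite P \<and> finite Q \<and> finite S \<and>
     avoids P Q \<and> avoids P S \<and> avoids Q P \<and> avoids Q S \<and> avoids S P \<and> avoids S Q"

definition collinear_triples ::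
  "(real^2) set \<Rightarrow> (real^2) set \<Rightarrow> (real^2) set \<Rightarrow> ((real^2) \<times> (real^2) \<times> (real^2)) set" where
  "collinear_triples A B C = {(a, b, c). a \<in> A \<and> b \<in> B \<and> c \<in> C \<and> collinear {a, b, c}}"

definition triple_hypergraph ::
  "(real^2) set \<Rightarrow> (real^2) set \<Rightarrow> (real^2) set \<Rightarrow> (real^2) set set" where
  "triple_hypergraph A B C = (\<lambda>(a, b, c). {a, b, c}) ` collinear_triples A B C"

text \<open>Injectivity says that the nine vertices are distinct; hence the three rows and three
  columns are six different edges.\<close>

definition tic_tac_toe :: "'a set set \<Rightarrow> bool" where
  "tic_tac_toe E \<longleftrightarrow>
     (\<exists>x :: nat \<Rightarrow> nat \<Rightarrow> 'a.
        inj_on (\<lambda>(i, j). x i j) ({1..3} \<times> {1..3}) \<and>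
        E = (\<lambda>i. {x i 1, x i 2, x i 3}) ` {1..3} \<union> (\<lambda>j. {x 1 j, x 2 j, x 3 j}) ` {1..3})"

end

theory Submission
  imports Defs
begin

text \<open>Mutual avoidance makes the collinear triples a linear 3-partite system, and the class that provides
  the middle point is the same for all of them. Ordering every class by angle as seen from another
  one, a triple that moves strictly down in two classes moves down in the third. Cut each ordered class
  into intervals of bounded length \<open>K\<close>: by monotonicity only \<open>O((n/K)\<^sup>2)\<close> products of intervals contain
  a triple, so many of them are dense, and the (6,3)-theorem yields a local triangle \<open>(a, b, c')\<close>,
  \<open>(a', b, c)\<close>, \<open>(a, b', c)\<close> inside each dense one. By pigeonhole \<open>\<Omega>(n\<^sup>2)\<close> of these triangles have the
  same shape; the (6,3)-theorem applied to their corners gives a triangle of corners, and the six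
  remaining triples of the three local triangles form a tic-tac-toe.

  The (6,3)-theorem comes from an energy decrement: if there is no triangle, then for each \<open>c\<close> the pairs
  completed by \<open>c\<close> form an induced matching, whose vertex sets span a hole in a dense cell of the current
  partition, so refining by these vertex sets improves the best step function approximation of the
  set of pairs by a fixed proportion of \<open>n\<^sup>2\<close>.\<close>

section \<open>The (6,3)-theorem for linear 3-partite systems\<close>

definition linear_triples :: "('a \<times> 'b \<times> 'c) set \<Rightarrow> bool" where
  "linear_triples T \<longleftrightarrow>
     (\<forall>a b c a' b' c'. (a, b, c) \<in> T \<longrightarrow> (a', b', c') \<in> T \<longrightarrow>
        (a = a' \<and> b = b' \<longrightarrow> c = c') \<and> (a = a' \<and> c = c' \<longrightarrow> b = b') \<and> (b = b' \<and> c = c' \<longrightarrow> a = a'))"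

definition pair_shadow :: "('a \<times> 'b \<times> 'c) set \<Rightarrow> ('a \<times> 'b) set" where
  "pair_shadow T = {(a, b). \<exists>c. (a, b, c) \<in> T}"

text \<open>For linear triples \<open>c = c'\<close> forces \<open>a = a'\<close> and
  \<open>b = b'\<close>, so only the degenerate triangle is allowed. For fixed \<open>c\<close> this
  says that the pairs completed by \<open>c\<close> form an induced matching in
  \<open>pair_shadow T\<close>.\<close>

definition triangle_free :: "('a \<times> 'b \<times> 'c) set \<Rightarrow> bool" where
  "triangle_free T \<longleftrightarrow>
     (\<forall>a b c a' b' c'. (a, b, c') \<in> T \<longrightarrow> (a', b, c) \<in> T \<longrightarrow> (a, b', c) \<in> T \<longrightarrow> c = c')"

section \<open>Step function approximations of a bipartite graph\<close>

definition sq_err :: "'a set \<Rightarrow> 'b set \<Rightarrow> ('a \<times> 'b) set \<Rightarrow> ('a \<Rightarrow> 'b \<Rightarrow> real) \<Rightarrow> real" where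
  "sq_err A B E f = (\<Sum>(a, b)\<in>A \<times> B. (of_bool ((a, b) \<in> E) - f a b)\<^sup>2)"

text \<open>Partitions are encoded as labellings by \<open>k\<close> labels, so cells may be empty
  and only the number of labels matters.\<close>

definition step_approx :: "'a set \<Rightarrow> 'b set \<Rightarrow> ('a \<times> 'b) set \<Rightarrow> nat \<Rightarrow> real \<Rightarrow> bool" where
  "step_approx A B E k x \<longleftrightarrow>
     (\<exists>\<pi> \<rho> h. \<pi> \<in> A \<rightarrow> {..<k} \<and> \<rho> \<in> B \<rightarrow> {..<k} \<and> sq_err A B E (\<lambda>a b. h (\<pi> a) (\<rho> b)) \<le> x)"

text \<open>Frees the choice of labels: the refinement below labels points by pairs of an old label
  and a set of old labels.\<close>

lemma step_approx_relabel:
  fixes \<pi> :: "'a \<Rightarrow> 'l" and \<rho> :: "'b \<Rightarrow> 'm"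
  assumes "\<pi> \<in> A \<rightarrow> X" "finite X" "card X \<le> k" "\<rho> \<in> B \<rightarrow> Y" "finite Y" "card Y \<le> k"
    and err: "sq_err A B E (\<lambda>a b. h (\<pi> a) (\<rho> b)) \<le> x"
  shows "step_approx A B E k x"
proof -
  obtain e where e: "bij_betw e X {..<card X}"
    using ex_bij_betw_finite_nat[OF \<open>finite X\<close>] atLeast0LessThan by metis
  obtain f where f: "bij_betw f Y {..<card Y}"
    using ex_bij_betw_finite_nat[OF \<open>finite Y\<close>] atLeast0LessThan by metis
  define h' where "h' = (\<lambda>i j. h (inv_into X e i) (inv_into Y f j))"
  have "sq_err A B E (\<lambda>a b. h' ((e \<circ> \<pi>) a) ((f \<circ> \<rho>) b)) = sq_err A B E (\<lambda>a b. h (\<pi> a) (\<rho> b))"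
    unfolding sq_err_def
  proof (rule sum.cong[OF refl], clarify)
    fix a b assume ab: "a \<in> A" "b \<in> B"
    have "inv_into X e (e (\<pi> a)) = \<pi> a" "inv_into Y f (f (\<rho> b)) = \<rho> b"
      using ab assms(1,4) e f by (auto intro!: inv_into_f_f simp: bij_betw_def)
    then show "(of_bool ((a, b) \<in> E) - h' ((e \<circ> \<pi>) a) ((f \<circ> \<rho>) b))\<^sup>2
        = (of_bool ((a, b) \<in> E) - h (\<pi> a) (\<rho> b))\<^sup>2"
      by (simp add: h'_def)
  qed
  moreover have "e \<circ> \<pi> \<in> A \<rightarrow> {..<k}"
    using bij_betwE[OF e] assms(1,3) by (force simp: Pi_iff)
  moreover have "f \<circ> \<rho> \<in> B \<rightarrow> {..<k}"
    using bij_betwE[OF f] assms(4,6) by (force simp: Pi_iff)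
  ultimately show ?thesis
    using err unfolding step_approx_def by (intro exI[of _ "e \<circ> \<pi>"] exI[of _ "f \<circ> \<rho>"] exI[of _ h']) simp
qed

lemma sum_over_cells:
  fixes F :: "'a \<times> 'b \<Rightarrow> real"
  assumes "finite A" "finite B" "\<pi> \<in> A \<rightarrow> {..<k::nat}" "\<rho> \<in> B \<rightarrow> {..<k::nat}"
  shows "(\<Sum>(i, j)\<in>{..<k} \<times> {..<k}. \<Sum>x\<in>{a\<in>A. \<pi> a = i} \<times> {b\<in>B. \<rho> b = j}. F x) = sum F (A \<times> B)"
proof -
  have "(\<Sum>ij\<in>{..<k} \<times> {..<k}. sum F {x \<in> A \<times> B. map_prod \<pi> \<rho> x = ij}) = sum F (A \<times> B)"
    by (rule sum.group) (use assms in auto)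
  moreover have "{x \<in> A \<times> B. map_prod \<pi> \<rho> x = ij} = {a\<in>A. \<pi> a = fst ij} \<times> {b\<in>B. \<rho> b = snd ij}" for ij
    by auto
  ultimately show ?thesis
    by (simp only: case_prod_unfold)
qed

definition edge_density :: "('a \<times> 'b) set \<Rightarrow> 'a set \<Rightarrow> 'b set \<Rightarrow> real" where
  "edge_density E X Y = card (E \<inter> X \<times> Y) / (card X * card Y)"

lemma sum_of_bool_card:
  "finite X \<Longrightarrow> (\<Sum>x\<in>X. of_bool (x \<in> E) :: real) = card (E \<inter> X)"
  by (simp add: of_bool_def sum.If_cases Int_commute)

text \<open>This form also covers empty cells, where division by zero makes the density 0.\<close>

lemma edge_density_times:
  assumes "finite X" "finite Y"
  shows "edge_density E X Y * (card X * card Y) = card (E \<inter> X \<times> Y)"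
proof (cases "card X * card Y = 0")
  case True
  then have "X \<times> Y = {}" using assms by auto
  then show ?thesis using True by (simp only: of_nat_mult[symmetric]) simp
qed (simp add: edge_density_def)

text \<open>The mean is the best constant: the two errors differ by exactly
  \<open>card X * card Y\<close> times the square of the distance from \<open>v\<close> to the
  density.\<close>

lemma edge_density_optimal_on_cell:
  assumes "finite X" "finite Y"
  shows "(\<Sum>x\<in>X \<times> Y. (of_bool (x \<in> E) - edge_density E X Y)\<^sup>2) \<le> (\<Sum>x\<in>X \<times> Y. (of_bool (x \<in> E) - v)\<^sup>2)"
proof -
  let ?d = "edge_density E X Y"
  have "(\<Sum>x\<in>X \<times> Y. (of_bool (x \<in> E) - v)\<^sup>2) - (\<Sum>x\<in>X \<times> Y. (of_bool (x \<in> E) - ?d)\<^sup>2)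
      = (\<Sum>x\<in>X \<times> Y. (v\<^sup>2 - ?d\<^sup>2) - 2 * (v - ?d) * of_bool (x \<in> E))"
    unfolding sum_subtractf[symmetric] by (rule sum.cong) (auto simp: power2_eq_square algebra_simps)
  also have "\<dots> = (card X * card Y) * (v\<^sup>2 - ?d\<^sup>2) - 2 * (v - ?d) * card (E \<inter> X \<times> Y)"
    using assms by (simp add: sum_subtractf sum_distrib_left[symmetric] sum_of_bool_card card_cartesian_product
        del: sum_of_bool_eq)
  also have "\<dots> = (card X * card Y) * (v - ?d)\<^sup>2"
    unfolding edge_density_times[OF assms, symmetric] by (simp add: power2_eq_square algebra_simps)
  finally show ?thesis by (smt (verit) mult_nonneg_nonneg of_nat_0_le_iff zero_le_power2)
qed

lemma edge_density_optimal:
  assumes "finite A" "finite B" "\<pi> \<in> A \<rightarrow> {..<k::nat}" "\<rho> \<in> B \<rightarrow> {..<k::nat}"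
  shows "sq_err A B E (\<lambda>a b. edge_density E {x\<in>A. \<pi> x = \<pi> a} {y\<in>B. \<rho> y = \<rho> b})
           \<le> sq_err A B E (\<lambda>a b. h (\<pi> a) (\<rho> b))"
proof -
  let ?P = "\<lambda>i. {x\<in>A. \<pi> x = i}" and ?Q = "\<lambda>j. {y\<in>B. \<rho> y = j}"
  have *: "sq_err A B E (\<lambda>a b. g (\<pi> a) (\<rho> b))
     = (\<Sum>(i, j)\<in>{..<k} \<times> {..<k}. \<Sum>x\<in>?P i \<times> ?Q j. (of_bool (x \<in> E) - g i j)\<^sup>2)" for g
    unfolding sq_err_def sum_over_cells[OF assms, symmetric]
    by (intro sum.cong refl) (auto intro!: sum.cong)
  show ?thesis
    unfolding *[of "\<lambda>i j. edge_density E (?P i) (?Q j)"] *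
    by (intro sum_mono) (auto intro!: edge_density_optimal_on_cell simp: assms)
qed

text \<open>On \<open>S\<close> the graph lies below \<open>f\<close> by at least
  \<open>\<eta>\<close> on average, so \<open>f\<close> is lowered there by \<open>\<eta>\<close>.
  Expanding the square, the linear term gains \<open>2 * \<eta>^2 * card S\<close> and the quadratic
  term costs half of that.\<close>

lemma sq_err_decrement:
  fixes f :: "'a \<Rightarrow> 'b \<Rightarrow> real" and \<eta> :: real
  assumes "finite A" "finite B" "S \<subseteq> A \<times> B"
    and le: "(\<Sum>(a, b)\<in>S. of_bool ((a, b) \<in> E) - f a b) \<le> - \<eta> * card S" and "\<eta> \<ge> 0"
  shows "sq_err A B E (\<lambda>a b. f a b - \<eta> * of_bool ((a, b) \<in> S)) \<le> sq_err A B E f - \<eta>\<^sup>2 * card S"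
proof -
  let ?D = "\<lambda>x. of_bool (x \<in> E) - f (fst x) (snd x)"
  have fS: "finite S" using assms finite_subset by blast
  have "sq_err A B E (\<lambda>a b. f a b - \<eta> * of_bool ((a, b) \<in> S))
      = (\<Sum>x\<in>A \<times> B. (?D x)\<^sup>2 + (if x \<in> S then 2 * \<eta> * ?D x + \<eta>\<^sup>2 else 0))"
    unfolding sq_err_def by (rule sum.cong) (auto simp: power2_eq_square algebra_simps)
  also have "\<dots> = sq_err A B E f + (\<Sum>x\<in>S. 2 * \<eta> * ?D x + \<eta>\<^sup>2)"
    using assms by (simp add: sum.distrib sq_err_def case_prod_unfold sum.inter_restrict[symmetric] sum.If_cases Int_absorb1 del: sum_of_bool_eq)
  also have "(\<Sum>x\<in>S. 2 * \<eta> * ?D x + \<eta>\<^sup>2) = 2 * \<eta> * (\<Sum>(a, b)\<in>S. of_bool ((a, b) \<in> E) - f a b) + \<eta>\<^sup>2 * card S"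
    by (simp add: sum.distrib sum_distrib_left case_prod_unfold)
  also have "\<dots> \<le> 2 * \<eta> * (- \<eta> * card S) + \<eta>\<^sup>2 * card S"
    using le \<open>\<eta> \<ge> 0\<close> by (intro add_right_mono mult_left_mono) auto
  finally show ?thesis by (simp add: power2_eq_square algebra_simps)
qed

section \<open>Counting along fibres\<close>

lemma sum_fibres:
  fixes F :: "'a \<Rightarrow> real"
  assumes "finite X" "finite I" "\<pi> \<in> X \<rightarrow> I"
  shows "(\<Sum>i\<in>I. sum F {x\<in>X. \<pi> x = i}) = sum F X"
  by (rule sum.group) (use assms in auto)

lemma card_fibres:
  assumes "finite X" "finite I" "\<pi> \<in> X \<rightarrow> I"
  shows "(\<Sum>i\<in>I. real (card {x\<in>X. \<pi> x = i})) = card X"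
  using sum_fibres[OF assms, of "\<lambda>_. 1"] by simp

text \<open>A sparse fibre of \<open>V\<close> has fewer than \<open>\<epsilon>\<close> times as
  many points as the corresponding fibre of \<open>X\<close>, and the fibres of \<open>X\<close> add
  up to \<open>card X\<close>.\<close>

lemma card_sparse_fibres_le:
  fixes \<epsilon> :: real
  assumes "finite X" "finite I" "\<pi> \<in> X \<rightarrow> I" "V \<subseteq> X" "\<epsilon> \<ge> 0"
  shows "real (card {v\<in>V. card {x\<in>V. \<pi> x = \<pi> v} < \<epsilon> * card {x\<in>X. \<pi> x = \<pi> v}}) \<le> \<epsilon> * card X"
proof -
  let ?S = "{v\<in>V. card {x\<in>V. \<pi> x = \<pi> v} < \<epsilon> * card {x\<in>X. \<pi> x = \<pi> v}}"
  have fin: "finite V" using assms finite_subset by blast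
  have "real (card ?S) = (\<Sum>i\<in>I. real (card {x\<in>?S. \<pi> x = i}))"
    using assms fin by (intro card_fibres[symmetric]) auto
  also have "\<dots> \<le> (\<Sum>i\<in>I. \<epsilon> * card {x\<in>X. \<pi> x = i})"
  proof (rule sum_mono)
    fix i
    show "real (card {x\<in>?S. \<pi> x = i}) \<le> \<epsilon> * card {x\<in>X. \<pi> x = i}"
    proof (cases "{x\<in>?S. \<pi> x = i} = {}")
      case False
      then have "card {x\<in>V. \<pi> x = i} < \<epsilon> * card {x\<in>X. \<pi> x = i}" by auto
      moreover have "card {x\<in>?S. \<pi> x = i} \<le> card {x\<in>V. \<pi> x = i}"
        using fin by (intro card_mono) auto
      ultimately show ?thesis by linarith
    next
      case True
      then show ?thesis using \<open>\<epsilon> \<ge> 0\<close> by (simp only: True) simp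
    qed
  qed
  also have "\<dots> = \<epsilon> * card X"
    by (simp add: sum_distrib_left[symmetric] card_fibres[OF assms(1-3)])
  finally show ?thesis .
qed

lemma card_small_fibres_le:
  fixes m :: real
  assumes "finite X" "finite I" "\<pi> \<in> X \<rightarrow> I" "m \<ge> 0"
  shows "real (card {x\<in>X. card {y\<in>X. \<pi> y = \<pi> x} < m}) \<le> card I * m"
proof -
  let ?S = "{x\<in>X. card {y\<in>X. \<pi> y = \<pi> x} < m}"
  have "real (card ?S) = (\<Sum>i\<in>I. real (card {x\<in>?S. \<pi> x = i}))"
    using assms by (intro card_fibres[symmetric]) auto
  also have "\<dots> \<le> (\<Sum>i\<in>I. m)"
  proof (rule sum_mono)
    fix i
    show "real (card {x\<in>?S. \<pi> x = i}) \<le> m"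
    proof (cases "{x\<in>?S. \<pi> x = i} = {}")
      case False
      then have "card {x\<in>X. \<pi> x = i} < m" by auto
      moreover have "card {x\<in>?S. \<pi> x = i} \<le> card {x\<in>X. \<pi> x = i}"
        using assms by (intro card_mono) auto
      ultimately show ?thesis by linarith
    next
      case True
      then show ?thesis using \<open>m \<ge> 0\<close> by (simp only: True) simp
    qed
  qed
  finally show ?thesis by simp
qed

lemma card_le_Sigma:
  fixes r :: real
  assumes "inj_on f X" "f ` X \<subseteq> Sigma J V" "finite J" "\<And>j. j \<in> J \<Longrightarrow> finite (V j)"
    and "\<And>j. j \<in> J \<Longrightarrow> real (card (V j)) \<le> r" "card J \<le> n" "r \<ge> 0"
  shows "real (card X) \<le> n * r"
proof -
  have "card X \<le> card (Sigma J V)"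
    using assms by (intro card_inj_on_le[OF assms(1,2)]) auto
  also have "card (Sigma J V) = (\<Sum>j\<in>J. card (V j))" using assms by auto
  finally have "real (card X) \<le> (\<Sum>j\<in>J. real (card (V j)))" by (metis of_nat_le_iff of_nat_sum)
  also have "\<dots> \<le> (\<Sum>j\<in>J. r)" using assms by (intro sum_mono) auto
  also have "\<dots> \<le> n * r" using assms by (simp add: mult_right_mono)
  finally show ?thesis .
qed

section \<open>The energy decrement and its iteration\<close>

lemma linear_triples_inj:
  assumes "linear_triples T"
  shows "inj_on (\<lambda>(a, b, c). (a, b)) T" "inj_on (\<lambda>(a, b, c). (c, a)) T" "inj_on (\<lambda>(a, b, c). (c, b)) T"
proof -
  note * = assms[unfolded linear_triples_def, rule_format]
  show "inj_on (\<lambda>(a, b, c). (a, b)) T" by (rule inj_onI) (auto dest: *)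
  show "inj_on (\<lambda>(a, b, c). (c, a)) T" by (rule inj_onI) (auto dest: *)
  show "inj_on (\<lambda>(a, b, c). (c, b)) T" by (rule inj_onI) (auto dest: *)
qed

text \<open>The dense cells with a suitable \<open>c\<close> cover at least \<delta>/2 * n^2 pairs.
  In each of them the neighbourhoods of \<open>c\<close> span a hole that takes up a fraction of at
  least (\<delta>/8)^2 of the cell and has density at most \<delta>/16, while the cell has density
  at least \<delta>/8. Lowering the step function by \<delta>/16 on all holes gains (\<delta>/16)^2
  * (\<delta>/8)^2 * \<delta>/2 * n^2, which is the stated decrement.\<close>

lemma step_approx_improve:
  fixes A :: "'a set" and B :: "'b set" and C :: "'c set" and \<delta> :: real
  assumes fin: "finite A" "finite B" "finite C" and cards: "card A \<le> n" "card B \<le> n" "card C \<le> n"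
    and T: "T \<subseteq> A \<times> B \<times> C" "linear_triples T" "triangle_free T" "card T \<ge> \<delta> * (real n)\<^sup>2"
    and \<delta>: "\<delta> > 0" and n: "real n \<ge> 1024 * k / \<delta> ^ 3" "n > 0" "k > 0"
    and approx: "step_approx A B (pair_shadow T) k x"
  shows "step_approx A B (pair_shadow T) (k * 2 ^ k) (x - \<delta> ^ 5 / 32768 * (real n)\<^sup>2)"
proof -
  define E where "E = pair_shadow T"
  note E_iff = pair_shadow_def[of T, folded E_def]
  obtain \<pi> \<rho> h where \<pi>: "\<pi> \<in> A \<rightarrow> {..<k}" and \<rho>: "\<rho> \<in> B \<rightarrow> {..<k}"
    and h: "sq_err A B E (\<lambda>a b. h (\<pi> a) (\<rho> b)) \<le> x"
    using approx unfolding step_approx_def E_def by blast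
  define P Q where "P i = {x\<in>A. \<pi> x = i}" and "Q j = {y\<in>B. \<rho> y = j}" for i j
  define d where "d i j = edge_density E (P i) (Q j)" for i j
  define Uc where "Uc c = {a\<in>A. \<exists>b. (a, b, c) \<in> T}" for c
  define Wc where "Wc c = {b\<in>B. \<exists>a. (a, b, c) \<in> T}" for c
  define U W where "U c i = {a\<in>Uc c. \<pi> a = i}" and "W c j = {b\<in>Wc c. \<rho> b = j}" for c i j
  \<comment> \<open>The first two bounds make the hole a fixed fraction of the cell, the third makes
    the cell visibly denser than the hole, and the last makes the hole so large that a matching in
    it is sparse.\<close>
  define good where "good i j c \<longleftrightarrow> c \<in> C \<and> \<delta> / 8 * card (P i) \<le> card (U c i)
      \<and> \<delta> / 8 * card (Q j) \<le> card (W c j) \<and> \<delta> / 8 \<le> d i j \<and> \<delta> * n / (8 * k) \<le> card (P i)" for i j c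
  define G where "G = {(i, j)\<in>{..<k} \<times> {..<k}. \<exists>c. good i j c}"
  define \<gamma> where "\<gamma> i j = (SOME c. good i j c)" for i j
  have \<gamma>: "good i j (\<gamma> i j)" if "(i, j) \<in> G" for i j
    using that someI_ex[of "good i j"] unfolding G_def \<gamma>_def by auto
  have ET: "E \<subseteq> A \<times> B" using T(1) unfolding E_iff by auto
  have finUW: "finite (P i)" "finite (Q j)" "finite (U c i)" "finite (W c j)" "finite E" "finite T"
    "finite (Uc c)" "finite (Wc c)" for i j c
    using fin ET T(1) finite_subset[of T "A \<times> B \<times> C"] finite_subset[of E "A \<times> B"]
    unfolding P_def Q_def U_def W_def Uc_def Wc_def by auto
  have finG: "finite G" unfolding G_def by (rule finite_subset[of _ "{..<k} \<times> {..<k}"]) auto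

  have Mge: "card {x\<in>A \<times> B. map_prod \<pi> \<rho> x \<in> G} \<ge> \<delta> / 2 * (real n)\<^sup>2" (is "real (card ?M) \<ge> _")
  proof -
    let ?V1 = "\<lambda>c. {v\<in>Uc c. card {x\<in>Uc c. \<pi> x = \<pi> v} < \<delta> / 8 * card {x\<in>A. \<pi> x = \<pi> v}}"
    let ?V2 = "\<lambda>c. {v\<in>Wc c. card {x\<in>Wc c. \<rho> x = \<rho> v} < \<delta> / 8 * card {x\<in>B. \<rho> x = \<rho> v}}"
    let ?V3 = "{e\<in>E. card {x\<in>E. map_prod \<pi> \<rho> x = map_prod \<pi> \<rho> e}
        < \<delta> / 8 * card {x\<in>A \<times> B. map_prod \<pi> \<rho> x = map_prod \<pi> \<rho> e}}"
    let ?V4 = "{v\<in>A. card {x\<in>A. \<pi> x = \<pi> v} < \<delta> * n / (8 * k)}"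
    \<comment> \<open>Each of the four bounds in \<open>good\<close> fails for at most \<delta>/8 *
      n^2 triples, so \<open>T0\<close> keeps at least \<delta>/2 * n^2 of them.\<close>
    define T1 where "T1 = {(a, b, c)\<in>T. a \<in> ?V1 c}"
    define T2 where "T2 = {(a, b, c)\<in>T. b \<in> ?V2 c}"
    define T3 where "T3 = {(a, b, c)\<in>T. (a, b) \<in> ?V3}"
    define T4 where "T4 = {(a, b, c)\<in>T. a \<in> ?V4}"
    define T0 where "T0 = T - T1 - T2 - T3 - T4"
    note inj = linear_triples_inj[OF T(2)]
    have 1: "real (card T1) \<le> n * (\<delta> / 8 * n)"
    proof (rule card_le_Sigma[where f = "\<lambda>(a, b, c). (c, a)" and J = C and V = ?V1])
      show "inj_on (\<lambda>(a, b, c). (c, a)) T1" by (rule inj_on_subset[OF inj(2)]) (auto simp: T1_def)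
      show "(\<lambda>(a, b, c). (c, a)) ` T1 \<subseteq> Sigma C ?V1" using T(1) by (auto simp: T1_def)
      show "real (card (?V1 c)) \<le> \<delta> / 8 * n" for c
      proof -
        have "real (card (?V1 c)) \<le> \<delta> / 8 * card A"
          using \<pi> \<delta> fin by (intro card_sparse_fibres_le[where I = "{..<k}"]) (auto simp: Uc_def)
        also have "\<dots> \<le> \<delta> / 8 * n" using cards \<delta> by (intro mult_left_mono) auto
        finally show ?thesis .
      qed
    qed (use fin cards \<delta> finUW in auto)
    have 2: "real (card T2) \<le> n * (\<delta> / 8 * n)"
    proof (rule card_le_Sigma[where f = "\<lambda>(a, b, c). (c, b)" and J = C and V = ?V2])
      show "inj_on (\<lambda>(a, b, c). (c, b)) T2" by (rule inj_on_subset[OF inj(3)]) (auto simp: T2_def)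
      show "(\<lambda>(a, b, c). (c, b)) ` T2 \<subseteq> Sigma C ?V2" using T(1) by (auto simp: T2_def)
      show "real (card (?V2 c)) \<le> \<delta> / 8 * n" for c
      proof -
        have "real (card (?V2 c)) \<le> \<delta> / 8 * card B"
          using \<rho> \<delta> fin by (intro card_sparse_fibres_le[where I = "{..<k}"]) (auto simp: Wc_def)
        also have "\<dots> \<le> \<delta> / 8 * n" using cards \<delta> by (intro mult_left_mono) auto
        finally show ?thesis .
      qed
    qed (use fin cards \<delta> finUW in auto)
    have 3: "real (card T3) \<le> n * (\<delta> / 8 * n)"
    proof -
      have "card T3 \<le> card ?V3"
      proof (rule card_inj_on_le)
        show "inj_on (\<lambda>(a, b, c). (a, b)) T3" by (rule inj_on_subset[OF inj(1)]) (auto simp: T3_def)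
      qed (use finUW in \<open>auto simp: T3_def\<close>)
      also have "real (card ?V3) \<le> \<delta> / 8 * card (A \<times> B)"
        using \<pi> \<rho> \<delta> fin ET by (intro card_sparse_fibres_le[where I = "{..<k} \<times> {..<k}"]) auto
      also have "\<dots> \<le> \<delta> / 8 * (real n * real n)"
        using cards \<delta> by (intro mult_left_mono) (auto simp: card_cartesian_product intro!: mult_mono)
      finally show ?thesis by (simp add: algebra_simps)
    qed
    have 4: "real (card T4) \<le> n * (\<delta> / 8 * n)"
    proof -
      have "real (card ?V4) \<le> card {..<k} * (\<delta> * n / (8 * k))"
        using \<pi> \<delta> fin by (intro card_small_fibres_le) auto
      then have V4: "real (card ?V4) \<le> \<delta> / 8 * n" using n by simp
      have "card T4 \<le> card (?V4 \<times> B)"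
      proof (rule card_inj_on_le)
        show "inj_on (\<lambda>(a, b, c). (a, b)) T4" by (rule inj_on_subset[OF inj(1)]) (auto simp: T4_def)
      qed (use T(1) fin in \<open>auto simp: T4_def\<close>)
      then have "real (card T4) \<le> real (card ?V4) * card B"
        by (simp add: card_cartesian_product flip: of_nat_mult)
      also have "\<dots> \<le> (\<delta> / 8 * n) * n" using V4 cards \<delta> by (intro mult_mono) auto
      finally show ?thesis by (simp add: algebra_simps)
    qed
    have "card T \<le> card T0 + card T1 + card T2 + card T3 + card T4"
    proof -
      have "card T \<le> card (T0 \<union> T1 \<union> T2 \<union> T3 \<union> T4)"
      proof (rule card_mono)
        have "T1 \<subseteq> T" "T2 \<subseteq> T" "T3 \<subseteq> T" "T4 \<subseteq> T"
          by (auto simp: T1_def T2_def T3_def T4_def)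
        then show "finite (T0 \<union> T1 \<union> T2 \<union> T3 \<union> T4)"
          using finUW(6) finite_subset[of _ T] by (auto simp: T0_def)
      qed (auto simp: T0_def)
      also have "\<dots> \<le> card T0 + card T1 + card T2 + card T3 + card T4"
        using card_Un_le[of "T0 \<union> T1 \<union> T2 \<union> T3" T4] card_Un_le[of "T0 \<union> T1 \<union> T2" T3]
          card_Un_le[of "T0 \<union> T1" T2] card_Un_le[of T0 T1] by linarith
      finally show ?thesis .
    qed
    then have "real (card T) \<le> card T0 + card T1 + card T2 + card T3 + card T4"
      by (metis of_nat_add of_nat_le_iff)
    then have T0: "card T0 \<ge> \<delta> / 2 * (real n)\<^sup>2"
      using 1 2 3 4 T(4) by (simp add: power2_eq_square algebra_simps)
    have "card T0 \<le> card ?M"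
    proof (rule card_inj_on_le)
      show "inj_on (\<lambda>(a, b, c). (a, b)) T0" by (rule inj_on_subset[OF inj(1)]) (auto simp: T0_def)
      show "(\<lambda>(a, b, c). (a, b)) ` T0 \<subseteq> ?M"
      proof clarsimp
        fix a b c assume t0: "(a, b, c) \<in> T0"
        then have t: "(a, b, c) \<in> T" by (simp add: T0_def)
        then have mem: "a \<in> A" "b \<in> B" "c \<in> C" "(a, b) \<in> E" "a \<in> Uc c" "b \<in> Wc c"
          using T(1) by (auto simp: E_iff Uc_def Wc_def)
        have e1: "{x \<in> E. map_prod \<pi> \<rho> x = (\<pi> a, \<rho> b)} = E \<inter> P (\<pi> a) \<times> Q (\<rho> b)"
          using ET by (auto simp: P_def Q_def)
        have e2: "{x \<in> A \<times> B. map_prod \<pi> \<rho> x = (\<pi> a, \<rho> b)} = P (\<pi> a) \<times> Q (\<rho> b)"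
          by (auto simp: P_def Q_def)
        have "good (\<pi> a) (\<rho> b) c"
          unfolding good_def
        proof (intro conjI)
          show "c \<in> C" by fact
          show "\<delta> / 8 * card (P (\<pi> a)) \<le> card (U c (\<pi> a))"
            using t0 t mem unfolding T0_def T1_def P_def U_def by auto
          show "\<delta> / 8 * card (Q (\<rho> b)) \<le> card (W c (\<rho> b))"
            using t0 t mem unfolding T0_def T2_def Q_def W_def by auto
          show "\<delta> * n / (8 * k) \<le> card (P (\<pi> a))"
            using t0 t mem unfolding T0_def T4_def P_def by auto
          have "\<delta> / 8 * card (P (\<pi> a) \<times> Q (\<rho> b)) \<le> card (E \<inter> P (\<pi> a) \<times> Q (\<rho> b))"
            using t0 t mem unfolding T0_def T3_def by (auto simp: e1 e2 map_prod_simp)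
          moreover have "P (\<pi> a) \<noteq> {}" "Q (\<rho> b) \<noteq> {}" using mem by (auto simp: P_def Q_def)
          then have "card (P (\<pi> a)) > 0" "card (Q (\<rho> b)) > 0" using finUW by (auto simp: card_gt_0_iff)
          ultimately show "\<delta> / 8 \<le> d (\<pi> a) (\<rho> b)"
            unfolding d_def edge_density_def by (subst pos_le_divide_eq) (auto simp: card_cartesian_product)
        qed
        then show "a \<in> A \<and> b \<in> B \<and> (\<pi> a, \<rho> b) \<in> G"
          using mem \<pi> \<rho> unfolding G_def by auto
      qed
      show "finite ?M" using fin by auto
    qed
    then show ?thesis using T0 by linarith
  qed

  \<comment> \<open>The union of the holes, one for each cell of \<open>G\<close>. A single witness
    per cell keeps the number of new labels bounded in terms of \<open>k\<close>.\<close>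
  define S where "S = {(a, b)\<in>A \<times> B. (\<pi> a, \<rho> b) \<in> G \<and>
      a \<in> U (\<gamma> (\<pi> a) (\<rho> b)) (\<pi> a) \<and> b \<in> W (\<gamma> (\<pi> a) (\<rho> b)) (\<rho> b)}"
  have finS: "finite S" by (rule finite_subset[of _ "A \<times> B"]) (use fin in \<open>auto simp: S_def\<close>)
  have Sfib: "{x\<in>S. map_prod \<pi> \<rho> x = (i, j)} = U (\<gamma> i j) i \<times> W (\<gamma> i j) j" if "(i, j) \<in> G" for i j
    using that by (auto simp: S_def U_def W_def Uc_def Wc_def)
  have Smap: "map_prod \<pi> \<rho> \<in> S \<rightarrow> G" by (auto simp: S_def)

  have Sge: "card S \<ge> (\<delta> / 8)\<^sup>2 * (\<delta> / 2 * (real n)\<^sup>2)"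
  proof -
    have "real (card ?M) = (\<Sum>ij\<in>G. real (card {x\<in>?M. map_prod \<pi> \<rho> x = ij}))"
      using fin finG by (intro card_fibres[symmetric]) auto
    also have "\<dots> = (\<Sum>(i, j)\<in>G. real (card (P i \<times> Q j)))"
    proof (rule sum.cong[OF refl], clarify)
      fix i j assume "(i, j) \<in> G"
      then have "{x\<in>?M. map_prod \<pi> \<rho> x = (i, j)} = P i \<times> Q j" by (auto simp: P_def Q_def)
      then show "real (card {x\<in>?M. map_prod \<pi> \<rho> x = (i, j)}) = real (card (P i \<times> Q j))" by simp
    qed
    finally have M: "real (card ?M) = (\<Sum>(i, j)\<in>G. real (card (P i \<times> Q j)))" .
    have "(\<delta> / 8)\<^sup>2 * (\<delta> / 2 * (real n)\<^sup>2) \<le> (\<delta> / 8)\<^sup>2 * card ?M"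
      using Mge by (intro mult_left_mono) auto
    also have "\<dots> \<le> (\<Sum>(i, j)\<in>G. real (card (U (\<gamma> i j) i \<times> W (\<gamma> i j) j)))"
      unfolding M sum_distrib_left
    proof (rule sum_mono, clarify)
      fix i j assume "(i, j) \<in> G"
      then have "(\<delta> / 8 * card (P i)) * (\<delta> / 8 * card (Q j)) \<le> real (card (U (\<gamma> i j) i)) * card (W (\<gamma> i j) j)"
        using \<gamma>[of i j] \<delta> unfolding good_def by (intro mult_mono) auto
      then show "(\<delta> / 8)\<^sup>2 * real (card (P i \<times> Q j)) \<le> real (card (U (\<gamma> i j) i \<times> W (\<gamma> i j) j))"
        by (simp add: card_cartesian_product power2_eq_square algebra_simps)
    qed
    also have "\<dots> = (\<Sum>ij\<in>G. real (card {x\<in>S. map_prod \<pi> \<rho> x = ij}))"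
      by (rule sum.cong) (auto simp: Sfib)
    also have "\<dots> = card S" using card_fibres[OF finS finG Smap] .
    finally show ?thesis .
  qed

  have hole: "card (E \<inter> U c i \<times> W c j) \<le> \<delta> / 16 * (real (card (U c i)) * card (W c j))"
    if "good i j c" for i j c
  proof -
    have "card (E \<inter> U c i \<times> W c j) \<le> card (W c j)"
    proof (rule card_inj_on_le)
      \<comment> \<open>Triangle-freeness says that the matching of the pairs completed by \<open>c\<close> is induced.\<close>
      have *: "(a, b, c) \<in> T" if ab: "(a, b) \<in> E \<inter> U c i \<times> W c j" for a b
      proof -
        obtain c' a' b' where "(a, b, c') \<in> T" "(a', b, c) \<in> T" "(a, b', c) \<in> T"
          using ab unfolding E_iff U_def W_def Uc_def Wc_def by auto
        then show ?thesis using T(3)[unfolded triangle_free_def, rule_format, of a b c' a' c b'] by simp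
      qed
      show "inj_on snd (E \<inter> U c i \<times> W c j)"
      proof (rule inj_onI, clarify)
        fix a b a' b'
        assume "(a, b) \<in> E" "a \<in> U c i" "b \<in> W c j" "(a', b') \<in> E" "a' \<in> U c i" "b' \<in> W c j"
          and eq: "snd (a, b) = snd (a', b')"
        then have "(a, b, c) \<in> T" "(a', b', c) \<in> T" using * by blast+
        then show "a = a' \<and> b = b'"
          using T(2)[unfolded linear_triples_def, rule_format, of a b c a' b' c] eq by simp
      qed
    qed (use finUW in auto)
    \<comment> \<open>The lower bound on \<open>n\<close> is chosen for this: a matching has at most
      \<open>card (W c j)\<close> pairs, which is a density of at most \<delta>/16 once the other
      side of the hole has 16/\<delta> points.\<close>
    moreover have "16 / \<delta> \<le> card (U c i)"
    proof -
      have "16 / \<delta> = \<delta> / 8 * (\<delta> * (1024 * k / \<delta> ^ 3) / (8 * k))"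
        using \<delta> n by (simp add: field_simps power3_eq_cube)
      also have "\<dots> \<le> \<delta> / 8 * (\<delta> * n / (8 * k))"
        using n \<delta> by (intro mult_left_mono divide_right_mono) auto
      also have "\<dots> \<le> \<delta> / 8 * card (P i)"
        using that \<delta> unfolding good_def by (intro mult_left_mono) auto
      also have "\<dots> \<le> card (U c i)" using that unfolding good_def by auto
      finally show ?thesis .
    qed
    then have "1 \<le> \<delta> / 16 * card (U c i)" using \<delta> by (simp add: field_simps)
    then have "1 * real (card (W c j)) \<le> \<delta> / 16 * card (U c i) * card (W c j)"
      by (intro mult_right_mono) auto
    ultimately show ?thesis by simp
  qed

  have gap: "(\<Sum>(a, b)\<in>S. of_bool ((a, b) \<in> E) - d (\<pi> a) (\<rho> b)) \<le> - (\<delta> / 16) * card S"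
  proof -
    have "(\<Sum>(a, b)\<in>S. of_bool ((a, b) \<in> E) - d (\<pi> a) (\<rho> b))
        = (\<Sum>ij\<in>G. \<Sum>(a, b)\<in>{x\<in>S. map_prod \<pi> \<rho> x = ij}. of_bool ((a, b) \<in> E) - d (\<pi> a) (\<rho> b))"
      using sum_fibres[OF finS finG Smap] by simp
    also have "\<dots> \<le> (\<Sum>ij\<in>G. - (\<delta> / 16) * card {x\<in>S. map_prod \<pi> \<rho> x = ij})"
    proof (rule sum_mono, clarify)
      fix i j assume ij: "(i, j) \<in> G"
      let ?X = "U (\<gamma> i j) i" and ?Y = "W (\<gamma> i j) j"
      have "(\<Sum>(a, b)\<in>?X \<times> ?Y. of_bool ((a, b) \<in> E) - d (\<pi> a) (\<rho> b))
          = (\<Sum>x\<in>?X \<times> ?Y. of_bool (x \<in> E) - d i j)"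
        by (rule sum.cong) (auto simp: U_def W_def)
      also have "\<dots> = card (E \<inter> ?X \<times> ?Y) - d i j * (real (card ?X) * card ?Y)"
        using finUW by (simp add: sum_subtractf sum_of_bool_card card_cartesian_product del: sum_of_bool_eq)
      also have "\<dots> \<le> \<delta> / 16 * (real (card ?X) * card ?Y) - \<delta> / 8 * (real (card ?X) * card ?Y)"
        using hole[OF \<gamma>[OF ij]] \<gamma>[OF ij] unfolding good_def by (intro diff_mono mult_right_mono) auto
      finally show "(\<Sum>(a, b)\<in>{x\<in>S. map_prod \<pi> \<rho> x = (i, j)}. of_bool ((a, b) \<in> E) - d (\<pi> a) (\<rho> b))
          \<le> - (\<delta> / 16) * card {x\<in>S. map_prod \<pi> \<rho> x = (i, j)}"
        by (simp add: Sfib[OF ij] card_cartesian_product)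
    qed
    also have "\<dots> = - (\<delta> / 16) * card S"
      by (simp only: sum_distrib_left[symmetric] card_fibres[OF finS finG Smap])
    finally show ?thesis .
  qed

  \<comment> \<open>The new label of \<open>a\<close> records in which cells of its row
    \<open>a\<close> lies on the side of the hole, and likewise for \<open>b\<close>. Membership of
    \<open>(a, b)\<close> in \<open>S\<close> can be read off the two labels, at the price of
    \<open>k * 2 ^ k\<close> labels.\<close>
  define \<pi>' where "\<pi>' a = (\<pi> a, {j\<in>{..<k}. (\<pi> a, j) \<in> G \<and> a \<in> U (\<gamma> (\<pi> a) j) (\<pi> a)})" for a
  define \<rho>' where "\<rho>' b = (\<rho> b, {i\<in>{..<k}. (i, \<rho> b) \<in> G \<and> b \<in> W (\<gamma> i (\<rho> b)) (\<rho> b)})" for b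
  define h' where "h' u v = d (fst u) (fst v) - \<delta> / 16 * of_bool (fst v \<in> snd u \<and> fst u \<in> snd v)"
    for u v :: "nat \<times> nat set"
  have "sq_err A B E (\<lambda>a b. h' (\<pi>' a) (\<rho>' b))
      = sq_err A B E (\<lambda>a b. d (\<pi> a) (\<rho> b) - \<delta> / 16 * of_bool ((a, b) \<in> S))"
    unfolding sq_err_def
  proof (rule sum.cong[OF refl], clarify)
    fix a b assume "a \<in> A" "b \<in> B"
    then have "\<rho> b \<in> snd (\<pi>' a) \<and> \<pi> a \<in> snd (\<rho>' b) \<longleftrightarrow> (a, b) \<in> S"
      using \<pi> \<rho> by (auto simp: S_def \<pi>'_def \<rho>'_def)
    moreover have "fst (\<pi>' a) = \<pi> a" "fst (\<rho>' b) = \<rho> b" by (simp_all add: \<pi>'_def \<rho>'_def)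
    ultimately show "(of_bool ((a, b) \<in> E) - h' (\<pi>' a) (\<rho>' b))\<^sup>2
        = (of_bool ((a, b) \<in> E) - (d (\<pi> a) (\<rho> b) - \<delta> / 16 * of_bool ((a, b) \<in> S)))\<^sup>2"
      by (simp only: h'_def)
  qed
  also have "\<dots> \<le> sq_err A B E (\<lambda>a b. d (\<pi> a) (\<rho> b)) - (\<delta> / 16)\<^sup>2 * card S"
    by (rule sq_err_decrement[OF fin(1,2) _ gap]) (use \<delta> in \<open>auto simp: S_def\<close>)
  \<comment> \<open>The decrement is measured against the densities, which do at least as well as
    the given \<open>h\<close> on the same partition.\<close>
  also have "\<dots> \<le> x - (\<delta> / 16)\<^sup>2 * card S"
    using edge_density_optimal[OF fin(1,2) \<pi> \<rho>, of E h] h unfolding d_def P_def Q_def by simp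
  also have "\<dots> \<le> x - (\<delta> / 16)\<^sup>2 * ((\<delta> / 8)\<^sup>2 * (\<delta> / 2 * (real n)\<^sup>2))"
    using Sge by (intro diff_left_mono mult_left_mono) auto
  also have "\<dots> = x - \<delta> ^ 5 / 32768 * (real n)\<^sup>2"
    by (simp add: power2_eq_square eval_nat_numeral)
  finally have "sq_err A B E (\<lambda>a b. h' (\<pi>' a) (\<rho>' b)) \<le> x - \<delta> ^ 5 / 32768 * (real n)\<^sup>2" .
  moreover have "card ({..<k} \<times> Pow {..<k}) = k * 2 ^ k" by (simp add: card_cartesian_product card_Pow)
  moreover have "\<pi>' \<in> A \<rightarrow> {..<k} \<times> Pow {..<k}" "\<rho>' \<in> B \<rightarrow> {..<k} \<times> Pow {..<k}"
    using \<pi> \<rho> by (auto simp: \<pi>'_def \<rho>'_def)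
  ultimately show ?thesis
    unfolding E_def[symmetric]
    by (intro step_approx_relabel[where X = "{..<k} \<times> Pow {..<k}" and Y = "{..<k} \<times> Pow {..<k}"]) auto
qed

text \<open>With a single cell the error is at most n^2, and every round lowers it by a fixed
  proportion of n^2. A triangle-free system would make it negative after boundedly many
  rounds.\<close>

theorem triangle_removal_linear:
  fixes \<delta> :: real
  assumes "\<delta> > 0"
  obtains n0 where "\<And>n (A :: 'a set) (B :: 'b set) (C :: 'c set) T.
    \<lbrakk>n \<ge> n0; finite A; finite B; finite C; card A \<le> n; card B \<le> n; card C \<le> n;
     T \<subseteq> A \<times> B \<times> C; linear_triples T; card T \<ge> \<delta> * (real n)\<^sup>2\<rbrakk> \<Longrightarrow> \<not> triangle_free T"
proof -
  define hyp where "hyp n A B C T \<longleftrightarrow> finite A \<and> finite B \<and> finite C \<and> card A \<le> n \<and> card B \<le> n \<and> card C \<le> n \<and>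
    T \<subseteq> A \<times> B \<times> C \<and> linear_triples T \<and> real (card T) \<ge> \<delta> * (real n)\<^sup>2 \<and> triangle_free T"
    for n and A :: "'a set" and B :: "'b set" and C :: "'c set" and T
  define \<gamma> where "\<gamma> = \<delta> ^ 5 / 32768"
  have \<gamma>: "\<gamma> > 0" using assms by (simp add: \<gamma>_def)
  \<comment> \<open>The number of labels and the threshold are chosen before \<open>n\<close> and
    the system, so they depend on \<delta> and the number \<open>m\<close> of rounds only.\<close>
  have iter: "\<exists>k>0. \<exists>n0. \<forall>n\<ge>n0. \<forall>A B C T. hyp n A B C T \<longrightarrow>
      step_approx A B (pair_shadow T) k ((real n)\<^sup>2 - m * \<gamma> * (real n)\<^sup>2)" for m :: nat
  proof (induction m)
    case 0
    have "step_approx A B (pair_shadow T) 1 ((real n)\<^sup>2)" if "hyp n A B C T" for n A B C T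
    proof -
      have "sq_err A B (pair_shadow T) (\<lambda>a b. 0) \<le> (\<Sum>x\<in>A \<times> B. 1)"
        unfolding sq_err_def by (intro sum_mono) auto
      also have "\<dots> = real (card A) * card B" by (simp add: card_cartesian_product)
      also have "\<dots> \<le> real n * real n" using that by (intro mult_mono) (auto simp: hyp_def)
      finally show ?thesis unfolding step_approx_def power2_eq_square
        by (intro exI[of _ "\<lambda>_. 0"] exI[of _ "\<lambda>_ _. 0"]) auto
    qed
    then show ?case by (intro exI[of _ 1]) auto
  next
    case (Suc m)
    then obtain k n0 where k: "k > 0" and n0: "\<And>n A B C T. n \<ge> n0 \<Longrightarrow> hyp n A B C T \<Longrightarrow>
        step_approx A B (pair_shadow T) k ((real n)\<^sup>2 - m * \<gamma> * (real n)\<^sup>2)" by blast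
    define n1 where "n1 = max (max n0 1) (nat \<lceil>1024 * k / \<delta> ^ 3\<rceil>)"
    have "step_approx A B (pair_shadow T) (k * 2 ^ k) ((real n)\<^sup>2 - Suc m * \<gamma> * (real n)\<^sup>2)"
      if "n \<ge> n1" "hyp n A B C T" for n A B C T
    proof -
      have "real n \<ge> 1024 * k / \<delta> ^ 3" using that(1) unfolding n1_def by linarith
      moreover have "n > 0" "n \<ge> n0" using that(1) unfolding n1_def by auto
      ultimately have "step_approx A B (pair_shadow T) (k * 2 ^ k)
          ((real n)\<^sup>2 - m * \<gamma> * (real n)\<^sup>2 - \<gamma> * (real n)\<^sup>2)"
        unfolding \<gamma>_def using that(2) k assms n0[OF _ that(2)]
        by (intro step_approx_improve[where C = C]) (auto simp: hyp_def \<gamma>_def)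
      then show ?thesis by (simp add: algebra_simps)
    qed
    then show ?case using k by (intro exI[of _ "k * 2 ^ k"] conjI exI[of _ n1]) auto
  qed
  obtain m :: nat where m: "m * \<gamma> > 1"
    using \<gamma> reals_Archimedean3 by blast
  obtain k n0 where n0: "\<And>n A B C T. n \<ge> n0 \<Longrightarrow> hyp n A B C T \<Longrightarrow>
        step_approx A B (pair_shadow T) k ((real n)\<^sup>2 - m * \<gamma> * (real n)\<^sup>2)"
    using iter[of m] by blast
  have "\<not> hyp n A B C T" if "n \<ge> max n0 1" for n A B C T
  proof
    assume "hyp n A B C T"
    then have "step_approx A B (pair_shadow T) k ((real n)\<^sup>2 - m * \<gamma> * (real n)\<^sup>2)"
      using n0 that by simp
    then obtain f where "sq_err A B (pair_shadow T) f \<le> (real n)\<^sup>2 - m * \<gamma> * (real n)\<^sup>2"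
      unfolding step_approx_def by blast
    moreover have "sq_err A B (pair_shadow T) f \<ge> 0"
      unfolding sq_err_def by (intro sum_nonneg) auto
    moreover have "1 * (real n)\<^sup>2 < m * \<gamma> * (real n)\<^sup>2"
      using m that by (intro mult_strict_right_mono) auto
    ultimately show False by simp
  qed
  then show ?thesis using that[of "max n0 1"] unfolding hyp_def by blast
qed

section \<open>Grids in monotone systems\<close>

text \<open>A tic-tac-toe in 3-partite form: the rows are the triples with equal indices, and each
  of the other three triples, the columns, uses every index once and so meets each row in one
  vertex.\<close>

definition contains_grid :: "('a \<times> 'b \<times> 'c) set \<Rightarrow> bool" where
  "contains_grid T \<longleftrightarrow> (\<exists>a1 a2 a3 b1 b2 b3 c1 c2 c3.
     distinct [a1, a2, a3] \<and> distinct [b1, b2, b3] \<and> distinct [c1, c2, c3] \<and>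
     {(a1, b1, c1), (a2, b2, c2), (a3, b3, c3), (a3, b1, c2), (a2, b3, c1), (a1, b2, c3)} \<subseteq> T)"

lemma contains_gridI:
  assumes "distinct [a1, a2, a3]" "distinct [b1, b2, b3]" "distinct [c1, c2, c3]"
    "{(a1, b1, c1), (a2, b2, c2), (a3, b3, c3), (a3, b1, c2), (a2, b3, c1), (a1, b2, c3)} \<subseteq> T"
  shows "contains_grid T"
  unfolding contains_grid_def by (intro exI conjI) (fact assms)+

lemma contains_gridE:
  assumes "contains_grid T"
  obtains a1 a2 a3 b1 b2 b3 c1 c2 c3 where
    "distinct [a1, a2, a3]" "distinct [b1, b2, b3]" "distinct [c1, c2, c3]"
    "{(a1, b1, c1), (a2, b2, c2), (a3, b3, c3), (a3, b1, c2), (a2, b3, c1), (a1, b2, c3)} \<subseteq> T"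
  using assms unfolding contains_grid_def by (elim exE conjE) (rule that)

lemma linear_triplesD:
  assumes "linear_triples T" "(a, b, c) \<in> T" "(a', b', c') \<in> T"
  shows "a = a' \<Longrightarrow> b = b' \<Longrightarrow> c = c'" "a = a' \<Longrightarrow> c = c' \<Longrightarrow> b = b'" "b = b' \<Longrightarrow> c = c' \<Longrightarrow> a = a'"
  using assms unfolding linear_triples_def by blast+

text \<open>A triangle of \<open>T'\<close> becomes a grid once each of its three triples is replaced by two shifted ones,
  as in the hexagon of the Thomsen condition for 3-webs.\<close>

lemma contains_grid_of_triangle:
  assumes "\<not> triangle_free T'" "linear_triples T'"
    and shift: "\<And>a b c. (a, b, c) \<in> T' \<Longrightarrow> (\<phi> a, b, \<theta> c) \<in> T \<and> (a, \<psi> b, \<theta> c) \<in> T"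
    and sub: "T' \<subseteq> T"
    and apart: "\<And>a b c a' b' c'. (a, b, c) \<in> T' \<Longrightarrow> (a', b', c') \<in> T' \<Longrightarrow>
      \<phi> a \<noteq> a' \<and> \<psi> b \<noteq> b' \<and> \<theta> c \<noteq> c' \<and> (c \<noteq> c' \<longrightarrow> \<theta> c \<noteq> \<theta> c')"
  shows "contains_grid T"
proof -
  obtain a b c a' b' c' where t: "(a, b, c') \<in> T'" "(a', b, c) \<in> T'" "(a, b', c) \<in> T'" and "c \<noteq> c'"
    using assms(1) unfolding triangle_free_def by auto
  have "a \<noteq> a'" "b \<noteq> b'"
    using linear_triplesD(1)[OF assms(2) t(1) t(2)] linear_triplesD(1)[OF assms(2) t(1) t(3)] \<open>c \<noteq> c'\<close>
    by metis+
  then have "distinct [a, a', \<phi> a]" "distinct [b', \<psi> b, b]" "distinct [c, \<theta> c, \<theta> c']"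
    using \<open>c \<noteq> c'\<close> apart[OF t(1) t(1)] apart[OF t(1) t(2)] apart[OF t(1) t(3)] apart[OF t(3) t(1)]
      apart[OF t(3) t(3)] by auto
  \<comment> \<open>The corner \<open>(a, b, c')\<close> contributes both of its shifts; each of the
    other two contributes itself and one shift.\<close>
  moreover have "{(a, b', c), (a', \<psi> b, \<theta> c), (\<phi> a, b, \<theta> c'), (\<phi> a, b', \<theta> c), (a', b, c), (a, \<psi> b, \<theta> c')} \<subseteq> T"
    using t shift[OF t(1)] shift[OF t(2)] shift[OF t(3)] sub by auto
  ultimately show ?thesis
    unfolding contains_grid_def by blast
qed

text \<open>Strict in two coordinates and weak in the third: this form survives division of all
  coordinates by \<open>K\<close>.\<close>

definition monotone_triples :: "(nat \<times> nat \<times> nat) set \<Rightarrow> bool" where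
  "monotone_triples T \<longleftrightarrow>
     (\<forall>a b c a' b' c'. (a, b, c) \<in> T \<longrightarrow> (a', b', c') \<in> T \<longrightarrow> a < a' \<longrightarrow> b < b' \<longrightarrow> c \<le> c')"

lemma card_monotone_triples_le:
  assumes "X \<subseteq> {..<N} \<times> {..<N} \<times> {..<N}" "monotone_triples X"
  shows "card X \<le> 4 * N\<^sup>2"
proof -
  \<comment> \<open>On a diagonal \<open>a - b = const\<close> the points form a chain in the coordinates \<open>a\<close> and \<open>c\<close>,
    so they are determined by \<open>a + c\<close>.\<close>
  let ?f = "\<lambda>(a, b, c). (a + N - b, a + c)"
  have "inj_on ?f X"
  proof (rule inj_onI)
    fix x y assume xy: "x \<in> X" "y \<in> X" "?f x = ?f y"
    obtain a b c where x: "x = (a, b, c)" by (cases x)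
    obtain a' b' c' where y: "y = (a', b', c')" by (cases y)
    note eqs = x y
    have t: "(a, b, c) \<in> X" "(a', b', c') \<in> X" and eq: "a + N - b = a' + N - b'" "a + c = a' + c'"
      using xy by (auto simp: eqs)
    have "b < N" "b' < N" using t assms(1) by auto
    moreover have "a < a' \<Longrightarrow> b < b' \<Longrightarrow> c \<le> c'" "a' < a \<Longrightarrow> b' < b \<Longrightarrow> c' \<le> c"
      using assms(2) t unfolding monotone_triples_def by blast+
    moreover have "a + b' = a' + b" using eq(1) \<open>b < N\<close> \<open>b' < N\<close> by linarith
    ultimately show "x = y" unfolding eqs using eq(2) by (cases a a' rule: linorder_cases) auto
  qed
  moreover have "?f ` X \<subseteq> {..<2 * N} \<times> {..<2 * N}"
    using assms(1) by (auto; fastforce)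
  ultimately have "card X \<le> card ({..<2 * N} \<times> {..<2 * N})"
    by (intro card_inj_on_le) auto
  then show ?thesis by (simp add: card_cartesian_product power2_eq_square)
qed

section \<open>Boxes of side \<open>K\<close>\<close>

definition cell :: "nat \<Rightarrow> nat \<times> nat \<times> nat \<Rightarrow> nat \<times> nat \<times> nat" where
  "cell K = (\<lambda>(a, b, c). (a div K, b div K, c div K))"

lemma monotone_boxes:
  assumes "monotone_triples T"
  shows "monotone_triples (cell K ` T)"
proof -
  have less: "x < y" if "x div K < y div K" for x y
    using that div_le_mono[of y x K] by linarith
  have "c div K \<le> c' div K" if "(a, b, c) \<in> T" "(a', b', c') \<in> T" "a div K < a' div K" "b div K < b' div K"
    for a b c a' b' c'
    using assms that(1,2) less[OF that(3)] less[OF that(4)] unfolding monotone_triples_def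
    by (intro div_le_mono) blast
  then show ?thesis unfolding monotone_triples_def cell_def by auto
qed

lemma card_block:
  fixes K :: nat
  assumes "K > 0"
  shows "card {x. x div K = i} = K" "finite {x. x div K = i}"
proof -
  have *: "x div K = i \<longleftrightarrow> x \<in> {i * K..<i * K + K}" for x
  proof
    assume "x div K = i"
    then have "i * K + x mod K = x" using div_mult_mod_eq[of x K] by simp
    moreover have "x mod K < K" using assms by (rule mod_less_divisor)
    ultimately show "x \<in> {i * K..<i * K + K}" unfolding atLeastLessThan_iff by linarith
  next
    assume "x \<in> {i * K..<i * K + K}"
    then have "K * i \<le> x" "x < K * Suc i" by (simp_all add: mult.commute)
    then show "x div K = i" by (rule div_nat_eqI[of K i x])
  qed
  have "{x. x div K = i} = {i * K..<i * K + K}"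
    by (rule set_eqI) (simp only: mem_Collect_eq *)
  then show "card {x. x div K = i} = K" "finite {x. x div K = i}" by auto
qed

text \<open>By monotonicity at most 4 * N^2 boxes are occupied, so the poor ones hold at most
  \<delta>/8 * (N * K)^2, hence at most \<delta>/2 * n^2 triples. The rest lies in rich boxes, and
  by linearity a box holds at most K^2 triples.\<close>

lemma many_rich_boxes:
  fixes \<delta> :: real
  assumes T: "T \<subseteq> {..<n} \<times> {..<n} \<times> {..<n}" "linear_triples T" "monotone_triples T"
    and card: "card T \<ge> \<delta> * (real n)\<^sup>2" and "\<delta> > 0" "0 < K" "K \<le> n"
  shows "card {\<beta>\<in>cell K ` T. card {t\<in>T. cell K t = \<beta>} \<ge> \<delta> / 32 * (real K)\<^sup>2} * (real K)\<^sup>2 \<ge> \<delta> / 2 * (real n)\<^sup>2"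
    (is "real (card ?R) * _ \<ge> _")
proof -
  \<comment> \<open>The added 1 allows for an incomplete last block; \<open>K \<le> n\<close> still
    gives \<open>N * K \<le> 2 * n\<close>.\<close>
  define N where "N = n div K + 1"
  have finT: "finite T" by (rule finite_subset[OF T(1)]) auto
  have fibre: "card {t\<in>T. cell K t = \<beta>} \<le> K\<^sup>2" for \<beta>
  proof -
    obtain i j l where \<beta>: "\<beta> = (i, j, l)" by (cases \<beta>)
    have "card {t\<in>T. cell K t = \<beta>} \<le> card ({x. x div K = i} \<times> {x. x div K = j})"
    proof (rule card_inj_on_le)
      show "inj_on (\<lambda>(a, b, c). (a, b)) {t\<in>T. cell K t = \<beta>}"
        by (rule inj_on_subset[OF linear_triples_inj(1)[OF T(2)]]) auto
    qed (use card_block(2)[OF \<open>0 < K\<close>] in \<open>auto simp: \<beta> cell_def\<close>)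
    then show ?thesis using card_block[OF \<open>0 < K\<close>] by (simp add: card_cartesian_product power2_eq_square)
  qed
  have "card (cell K ` T) \<le> 4 * N\<^sup>2"
  proof (rule card_monotone_triples_le[OF _ monotone_boxes[OF T(3)]])
    have "x div K < N" if "x < n" for x
      using that unfolding N_def by (simp add: div_le_mono le_imp_less_Suc)
    then show "cell K ` T \<subseteq> {..<N} \<times> {..<N} \<times> {..<N}" using T(1) by (auto simp: cell_def)
  qed
  from of_nat_mono[OF this, where 'a = real]
  have boxes: "real (card (cell K ` T)) \<le> 4 * (real N)\<^sup>2" by simp
  have "N * K \<le> 2 * n"
    using \<open>K \<le> n\<close> div_times_less_eq_dividend[of n K] unfolding N_def add_mult_distrib by linarith
  then have "real (N * K) \<le> real (2 * n)" by (rule of_nat_mono)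
  then have "real N * real K \<le> 2 * real n" by simp
  then have NK: "(real N * real K)\<^sup>2 \<le> (2 * real n)\<^sup>2" by (intro power_mono) auto
  have "real (card T) = (\<Sum>\<beta>\<in>cell K ` T. real (card {t\<in>T. cell K t = \<beta>}))"
    using finT by (intro card_fibres[symmetric]) auto
  also have "\<dots> \<le> (\<Sum>\<beta>\<in>cell K ` T. (if \<beta> \<in> ?R then (real K)\<^sup>2 else 0) + \<delta> / 32 * (real K)\<^sup>2)"
  proof (rule sum_mono)
    fix \<beta> assume "\<beta> \<in> cell K ` T"
    moreover have "real (card {t\<in>T. cell K t = \<beta>}) \<le> (real K)\<^sup>2"
      using of_nat_mono[OF fibre, where 'a = real] by simp
    ultimately show "real (card {t\<in>T. cell K t = \<beta>}) \<le> (if \<beta> \<in> ?R then (real K)\<^sup>2 else 0) + \<delta> / 32 * (real K)\<^sup>2"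
      using \<open>\<delta> > 0\<close> by (auto intro: add_increasing2)
  qed
  also have "\<dots> = card ?R * (real K)\<^sup>2 + card (cell K ` T) * (\<delta> / 32 * (real K)\<^sup>2)"
  proof -
    have "(\<Sum>\<beta>\<in>cell K ` T. if \<beta> \<in> ?R then (real K)\<^sup>2 else 0) = card ?R * (real K)\<^sup>2"
    proof -
      have "(\<Sum>\<beta>\<in>cell K ` T. if \<beta> \<in> ?R then (real K)\<^sup>2 else 0) = (\<Sum>\<beta>\<in>?R. (real K)\<^sup>2)"
        using finT by (intro sum.mono_neutral_cong_right) auto
      then show ?thesis by simp
    qed
    then show ?thesis by (simp only: sum.distrib sum_constant)
  qed
  also have "card (cell K ` T) * (\<delta> / 32 * (real K)\<^sup>2) \<le> 4 * (real N)\<^sup>2 * (\<delta> / 32 * (real K)\<^sup>2)"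
    using boxes \<open>\<delta> > 0\<close> by (intro mult_right_mono) auto
  also have "\<dots> = \<delta> / 8 * (real N * real K)\<^sup>2" by (simp add: power_mult_distrib)
  also have "\<dots> \<le> \<delta> / 8 * (2 * real n)\<^sup>2" using NK \<open>\<delta> > 0\<close> by (intro mult_left_mono) auto
  finally show ?thesis using card by (simp add: power_mult_distrib)
qed

lemma pigeonhole_union:
  fixes m :: real
  assumes "finite I" "\<And>i. i \<in> I \<Longrightarrow> finite (X i)" "card (\<Union>i\<in>I. X i) \<ge> card I * m" "m > 0" "I \<noteq> {}"
  shows "\<exists>i\<in>I. card (X i) \<ge> m"
proof (rule ccontr)
  assume "\<not> ?thesis"
  then have "(\<Sum>i\<in>I. real (card (X i))) < (\<Sum>i\<in>I. m)" using assms by (intro sum_strict_mono) auto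
  moreover have "card (\<Union>i\<in>I. X i) \<le> (\<Sum>i\<in>I. card (X i))" by (rule card_UN_le[OF assms(1)])
  then have "real (card (\<Union>i\<in>I. X i)) \<le> (\<Sum>i\<in>I. real (card (X i)))" by (metis of_nat_le_iff of_nat_sum)
  ultimately show False using assms(3) by simp
qed

text \<open>The (6,3)-theorem is used twice. Inside boxes, with density \<delta>/32, it fixes a side
  \<open>K\<close> that depends on \<delta> only. The number of shapes of local triangles is then a
  constant, so some shape has quadratically many corners, to which the theorem is applied
  again.\<close>

theorem monotone_triples_contain_grid:
  fixes \<delta> :: real
  assumes "\<delta> > 0"
  obtains n0 where "\<And>n T. \<lbrakk>n \<ge> n0; T \<subseteq> {..<n} \<times> {..<n} \<times> {..<n}; linear_triples T; monotone_triples T;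
    card T \<ge> \<delta> * (real n)\<^sup>2\<rbrakk> \<Longrightarrow> contains_grid T"
proof -
  obtain K0 where K0: "\<And>n (A :: nat set) (B :: nat set) (C :: nat set) T.
    \<lbrakk>n \<ge> K0; finite A; finite B; finite C; card A \<le> n; card B \<le> n; card C \<le> n;
     T \<subseteq> A \<times> B \<times> C; linear_triples T; card T \<ge> \<delta> / 32 * (real n)\<^sup>2\<rbrakk> \<Longrightarrow> \<not> triangle_free T"
    by (rule triangle_removal_linear[of "\<delta> / 32"]) (use assms in auto)
  define K where "K = max K0 1"
  then have K: "K > 0" "K \<ge> K0" by auto
  \<comment> \<open>There are at least \<delta>/(2 * K^2) * n^2 rich boxes, and their corners are
    distributed over K^6 shapes.\<close>
  define \<delta>' where "\<delta>' = \<delta> / (2 * real K ^ 8)"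
  have "\<delta>' > 0" using assms K by (simp add: \<delta>'_def)
  obtain n1 where n1: "\<And>n (A :: nat set) (B :: nat set) (C :: nat set) T.
    \<lbrakk>n \<ge> n1; finite A; finite B; finite C; card A \<le> n; card B \<le> n; card C \<le> n;
     T \<subseteq> A \<times> B \<times> C; linear_triples T; card T \<ge> \<delta>' * (real n)\<^sup>2\<rbrakk> \<Longrightarrow> \<not> triangle_free T"
    using triangle_removal_linear[OF \<open>\<delta>' > 0\<close>] by blast
  have "contains_grid T" if "n \<ge> max n1 K" and T: "T \<subseteq> {..<n} \<times> {..<n} \<times> {..<n}" "linear_triples T"
    "monotone_triples T" and card: "real (card T) \<ge> \<delta> * (real n)\<^sup>2" for n T
  proof -
    have n: "n \<ge> n1" "n \<ge> K" "n > 0" using that(1) K by auto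
    have finT: "finite T" by (rule finite_subset[OF T(1)]) auto
    have lin_sub: "linear_triples T'" if "T' \<subseteq> T" for T'
      using T(2) that unfolding linear_triples_def by blast
    define Keys where "Keys = {..<K} \<times> {..<K} \<times> {..<K} \<times> {..<K} \<times> {..<K} \<times> {..<K}"
    have "finite Keys" by (simp add: Keys_def)
    have "(0, 0, 0, 0, 0, 0) \<in> Keys" using K by (simp add: Keys_def)
    then have "Keys \<noteq> {}" by blast
    \<comment> \<open>\<open>X\<close> collects the corners of the local triangles of one shape; a shape records the residues
      modulo \<open>K\<close> of all six coordinates, so no corner coordinate is a shift of another one.\<close>
    define X where "X = (\<lambda>(u, u', v, v', w, w'). {(a, b, c)\<in>T. a mod K = u \<and> b mod K = v \<and> c mod K = w \<and>
        u \<noteq> u' \<and> v \<noteq> v' \<and> w \<noteq> w' \<and> (K * (a div K) + u', b, K * (c div K) + w') \<in> T \<and>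
        (a, K * (b div K) + v', K * (c div K) + w') \<in> T})"
    have XT: "X \<kappa> \<subseteq> T" for \<kappa> by (auto simp: X_def split: prod.splits)
    then have finX: "finite (X \<kappa>)" for \<kappa> using finT finite_subset by blast
    define R where "R = {\<beta>\<in>cell K ` T. card {t\<in>T. cell K t = \<beta>} \<ge> \<delta> / 32 * (real K)\<^sup>2}"
    \<comment> \<open>Every rich box contains the corner of a local triangle. Since a corner
      determines its box, there are at least as many corners as rich boxes.\<close>
    have "R \<subseteq> cell K ` (\<Union>\<kappa>\<in>Keys. X \<kappa>)"
    proof
      fix \<beta> assume \<beta>: "\<beta> \<in> R"
      obtain i j l where ijl: "\<beta> = (i, j, l)" by (cases \<beta>)
      let ?T = "{t\<in>T. cell K t = \<beta>}"
      have "\<not> triangle_free ?T"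
      proof (rule K0[OF K(2), of "{x. x div K = i}" "{x. x div K = j}" "{x. x div K = l}"])
        show "?T \<subseteq> {x. x div K = i} \<times> {x. x div K = j} \<times> {x. x div K = l}" by (auto simp: ijl cell_def)
        show "linear_triples ?T" by (rule lin_sub) auto
        show "\<delta> / 32 * (real K)\<^sup>2 \<le> real (card ?T)" using \<beta> by (simp add: R_def)
      qed (simp_all add: card_block K)
      then obtain a b c a' b' c' where t: "(a, b, c') \<in> T" "(a', b, c) \<in> T" "(a, b', c) \<in> T"
        and \<beta>s: "cell K (a, b, c') = \<beta>" "cell K (a', b, c) = \<beta>" "cell K (a, b', c) = \<beta>" and "c \<noteq> c'"
        unfolding triangle_free_def by auto
      have "a \<noteq> a'" "b \<noteq> b'"
        using linear_triplesD(1)[OF T(2) t(1) t(2)] linear_triplesD(1)[OF T(2) t(1) t(3)] \<open>c \<noteq> c'\<close>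
        by metis+
      have dv: "a' div K = a div K" "b' div K = b div K" "c' div K = c div K"
        using \<beta>s by (auto simp: cell_def ijl)
      then have rec: "K * (a div K) + a' mod K = a'" "K * (b div K) + b' mod K = b'" "K * (c' div K) + c mod K = c"
        by (metis mult_div_mod_eq)+
      have "a mod K \<noteq> a' mod K" "b mod K \<noteq> b' mod K" "c' mod K \<noteq> c mod K"
        using dv \<open>a \<noteq> a'\<close> \<open>b \<noteq> b'\<close> \<open>c \<noteq> c'\<close> by (metis mult_div_mod_eq)+
      \<comment> \<open>The corner is \<open>(a, b, c')\<close>; the shifts of its coordinates
        within their blocks are \<open>a'\<close>, \<open>b'\<close> and \<open>c\<close>.\<close>
      then have "(a, b, c') \<in> X (a mod K, a' mod K, b mod K, b' mod K, c' mod K, c mod K)"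
        unfolding X_def by (simp only: prod.case mem_Collect_eq rec t) simp
      moreover have "(a mod K, a' mod K, b mod K, b' mod K, c' mod K, c mod K) \<in> Keys"
        using K by (simp add: Keys_def)
      ultimately show "\<beta> \<in> cell K ` (\<Union>\<kappa>\<in>Keys. X \<kappa>)" using \<beta>s(1) by blast
    qed
    moreover have finKX: "finite (\<Union>\<kappa>\<in>Keys. X \<kappa>)" using finX \<open>finite Keys\<close> by blast
    ultimately have "card R \<le> card (\<Union>\<kappa>\<in>Keys. X \<kappa>)"
      by (meson card_image_le card_mono finite_imageI le_trans)
    moreover have "\<delta> / 2 * (real n)\<^sup>2 \<le> card R * (real K)\<^sup>2"
      unfolding R_def using many_rich_boxes[OF T card assms K(1) n(2)] .
    then have "\<delta> / (2 * (real K)\<^sup>2) * (real n)\<^sup>2 \<le> card R" using K by (simp add: field_simps)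
    moreover have "card Keys = K ^ 6" by (simp add: Keys_def card_cartesian_product eval_nat_numeral)
    then have "card Keys * (\<delta>' * (real n)\<^sup>2) = \<delta> / (2 * (real K)\<^sup>2) * (real n)\<^sup>2"
      using K by (simp add: \<delta>'_def field_simps flip: power_add)
    ultimately have many: "card (\<Union>\<kappa>\<in>Keys. X \<kappa>) \<ge> card Keys * (\<delta>' * (real n)\<^sup>2)" by linarith
    moreover have "\<delta>' * (real n)\<^sup>2 > 0" using \<open>\<delta>' > 0\<close> n(3) by simp
    ultimately have "\<exists>\<kappa>\<in>Keys. card (X \<kappa>) \<ge> \<delta>' * (real n)\<^sup>2"
      by (intro pigeonhole_union[OF \<open>finite Keys\<close> finX _ _ \<open>Keys \<noteq> {}\<close>])
    have "\<delta>' * (real n)\<^sup>2 > 0" using \<open>\<delta>' > 0\<close> n(3) by simp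
    from pigeonhole_union[OF \<open>finite Keys\<close> finX many this \<open>Keys \<noteq> {}\<close>]
    obtain \<kappa> where "\<kappa> \<in> Keys" and \<kappa>: "card (X \<kappa>) \<ge> \<delta>' * (real n)\<^sup>2"
      by blast
    obtain u u' v v' w w' where uv: "\<kappa> = (u, u', v, v', w, w')" by (cases \<kappa>)
    have bounds: "u' < K" "v' < K" "w' < K" using \<open>\<kappa> \<in> Keys\<close> by (auto simp: Keys_def uv)
    show "contains_grid T"
    proof (rule contains_grid_of_triangle[where T' = "X \<kappa>"])
      show "\<not> triangle_free (X \<kappa>)"
        by (rule n1[OF n(1), of "{..<n}" "{..<n}" "{..<n}"])
          (use \<kappa> lin_sub[OF XT] order_trans[OF XT T(1)] in simp_all)
      show "linear_triples (X \<kappa>)" by (rule lin_sub[OF XT])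
      show "X \<kappa> \<subseteq> T" by (rule XT)
      show "(K * (a div K) + u', b, K * (c div K) + w') \<in> T \<and> (a, K * (b div K) + v', K * (c div K) + w') \<in> T"
        if "(a, b, c) \<in> X \<kappa>" for a b c
        using that by (simp add: X_def uv)
      show "K * (a div K) + u' \<noteq> a' \<and> K * (b div K) + v' \<noteq> b' \<and> K * (c div K) + w' \<noteq> c' \<and>
          (c \<noteq> c' \<longrightarrow> K * (c div K) + w' \<noteq> K * (c' div K) + w')"
        if "(a, b, c) \<in> X \<kappa>" "(a', b', c') \<in> X \<kappa>" for a b c a' b' c'
      proof (intro conjI impI)
        have res: "u \<noteq> u'" "v \<noteq> v'" "w \<noteq> w'" "a' mod K = u" "b' mod K = v" "c' mod K = w" "c mod K = w"
          using that by (auto simp: X_def uv)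
        have shifted: "(K * q + r) mod K = r" if "r < K" for q r using that by simp
        show "K * (a div K) + u' \<noteq> a'" "K * (b div K) + v' \<noteq> b'" "K * (c div K) + w' \<noteq> c'"
          using res bounds shifted by metis+
        \<comment> \<open>All corners of one shape have the same residue \<open>w\<close> in the
          last coordinate, so different values lie in different blocks.\<close>
        show "K * (c div K) + w' \<noteq> K * (c' div K) + w'" if "c \<noteq> c'"
          using that K(1) res(6,7) by (metis add_right_cancel mult_div_mod_eq)
      qed
    qed
  qed
  then show ?thesis using that[of "max n1 K"] by blast
qed

section \<open>Mutually avoiding sets\<close>

text \<open>Twice the signed area of the triangle \<open>p q r\<close>; its sign tells on which side
  of the directed line from \<open>p\<close> to \<open>q\<close> the point \<open>r\<close>
  lies.\<close>

definition orient :: "real^2 \<Rightarrow> real^2 \<Rightarrow> real^2 \<Rightarrow> real" where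
  "orient p q r = (q$1 - p$1) * (r$2 - p$2) - (q$2 - p$2) * (r$1 - p$1)"

lemma orient_swap: "orient q p r = - orient p q r"
  by (simp add: orient_def algebra_simps)

lemma orient_cyclic: "orient p q r = orient q r p"
  by (simp add: orient_def algebra_simps)

lemma orient_degenerate [simp]: "orient p q p = 0" "orient p q q = 0" "orient p p q = 0"
  by (simp_all add: orient_def)

lemma orient_affine: "orient p q ((1 - u) *\<^sub>R r + u *\<^sub>R s) = (1 - u) * orient p q r + u * orient p q s"
  by (simp add: orient_def algebra_simps)

text \<open>The three-term Grassmann-Pluecker relation for the vectors from \<open>q\<close>; it
  yields transitivity of the angular order around \<open>q\<close>.\<close>

lemma orient_pluecker:
  "orient q w y * orient q x z = orient q w x * orient q y z + orient q w z * orient q x y"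
  by (simp add: orient_def algebra_simps)

lemma orient_eq_0_imp_collinear_point:
  assumes "orient p q r = 0" "p \<noteq> q"
  shows "r \<in> affine hull {p, q}"
proof -
  have *: "(q$1 - p$1) * (r$2 - p$2) = (q$2 - p$2) * (r$1 - p$1)" using assms by (simp add: orient_def)
  have "\<exists>t. r$1 - p$1 = t * (q$1 - p$1) \<and> r$2 - p$2 = t * (q$2 - p$2)"
  proof (cases "q$1 = p$1")
    case True
    then have "q$2 \<noteq> p$2" using assms(2) by (auto simp: vec_eq_iff forall_2)
    then show ?thesis using * True by (intro exI[of _ "(r$2 - p$2) / (q$2 - p$2)"]) simp
  next
    case False
    then show ?thesis using * by (intro exI[of _ "(r$1 - p$1) / (q$1 - p$1)"]) (simp add: field_simps)
  qed
  then obtain t where "r$1 - p$1 = t * (q$1 - p$1)" "r$2 - p$2 = t * (q$2 - p$2)" by blast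
  then have "r = (1 - t) *\<^sub>R p + t *\<^sub>R q" by (simp add: vec_eq_iff forall_2 algebra_simps)
  then show ?thesis unfolding affine_hull_2 by (intro CollectI exI[of _ "1 - t"] exI[of _ t]) auto
qed

lemma collinear_imp_orient_eq_0:
  assumes "collinear {p, q, r}"
  shows "orient p q r = 0"
proof -
  have "collinear {0, p - q, r - q}" using assms collinear_3[of p q r, unfolded NO_MATCH_def] by simp
  then consider "p = q" | "r = q" | c where "r - q = c *\<^sub>R (p - q)" unfolding collinear_lemma by auto
  then show ?thesis
  proof cases
    case 3
    then have r: "r = q + c *\<^sub>R (p - q)" by (simp add: algebra_simps)
    show ?thesis unfolding r by (simp add: orient_def algebra_simps)
  qed (simp_all add: orient_def)
qed

text \<open>Otherwise the affine function \<open>orient p p'\<close> vanishes somewhere on the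
  segment from \<open>r\<close> to \<open>s\<close>, and there the line through \<open>p\<close> and
  \<open>p'\<close> meets the convex hull of \<open>Q\<close>.\<close>

lemma avoids_same_side:
  assumes "avoids P Q" "p \<in> P" "p' \<in> P" "p \<noteq> p'" "r \<in> Q" "s \<in> Q"
  shows "orient p p' r * orient p p' s > 0"
proof (rule ccontr)
  let ?f = "orient p p'"
  assume "\<not> ?thesis"
  then have neg: "?f r * ?f s \<le> 0" by simp
  have "\<exists>u. 0 \<le> u \<and> u \<le> 1 \<and> (1 - u) * ?f r + u * ?f s = 0"
  proof (cases "?f r = ?f s")
    case True
    then have "?f r = 0" using neg by (auto simp: mult_le_0_iff)
    then show ?thesis by (intro exI[of _ 0]) auto
  next
    case False
    show ?thesis
    proof (intro exI conjI)
      show "0 \<le> ?f r / (?f r - ?f s)" "?f r / (?f r - ?f s) \<le> 1"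
        using neg False by (auto simp: mult_le_0_iff zero_le_divide_iff divide_le_eq)
      show "(1 - ?f r / (?f r - ?f s)) * ?f r + ?f r / (?f r - ?f s) * ?f s = 0"
        using False by (simp add: field_simps)
    qed
  qed
  then obtain u where u: "0 \<le> u" "u \<le> 1" "(1 - u) * ?f r + u * ?f s = 0" by blast
  let ?x = "(1 - u) *\<^sub>R r + u *\<^sub>R s"
  have "?f ?x = 0" using u by (simp add: orient_affine)
  then have "?x \<in> affine hull {p, p'}" using assms(4) by (rule orient_eq_0_imp_collinear_point)
  moreover have "?x \<in> convex hull Q"
    using u assms(5,6) by (intro convexD_alt[OF convex_convex_hull] hull_inc) auto
  ultimately show False using assms(1-4) unfolding avoids_def by blast
qed

lemma avoids_orient_neq_0:
  assumes "avoids P Q" "p \<in> P" "p' \<in> P" "p \<noteq> p'" "r \<in> Q"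
  shows "orient p p' r \<noteq> 0"
  using avoids_same_side[OF assms(1-5) assms(5)] by auto

lemma card_ge_2_obtain:
  assumes "card P \<ge> 2"
  obtains p where "p \<in> P" "p \<noteq> x"
proof -
  have "\<not> P \<subseteq> {x}" using assms card_mono[of "{x}" P] by auto
  then show ?thesis using that by blast
qed

lemma avoids_disjoint:
  assumes "avoids P Q" "card P \<ge> 2"
  shows "P \<inter> Q = {}"
proof (rule ccontr)
  assume "P \<inter> Q \<noteq> {}"
  then obtain p where p: "p \<in> P" "p \<in> Q" by blast
  obtain p' where "p' \<in> P" "p' \<noteq> p" using card_ge_2_obtain[OF assms(2)] by blast
  then show False using avoids_orient_neq_0[OF assms(1) p(1) _ _ p(2), of p'] by simp
qed

text \<open>Two different points of \<open>S\<close> on the line \<open>xy\<close> would span this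
  line, which contains the point \<open>x\<close> of \<open>X\<close>. This is the source of
  linearity.\<close>

lemma avoids_collinear_unique:
  assumes "avoids S X" "s \<in> S" "s' \<in> S" "x \<in> X" "x \<noteq> y" "collinear {x, y, s}" "collinear {x, y, s'}"
  shows "s = s'"
proof (rule ccontr)
  assume "s \<noteq> s'"
  have "collinear {s, x, y}" using assms(6) by (simp add: insert_commute)
  then have "collinear {s, x, s'}" using assms(5,7) by (meson collinear_3_trans)
  then have "orient s s' x = 0" by (intro collinear_imp_orient_eq_0) (simp add: insert_commute)
  then show False using avoids_orient_neq_0[OF assms(1-3) \<open>s \<noteq> s'\<close> assms(4)] by simp
qed

section \<open>Angular orders\<close>

lemma strict_order_rank:
  assumes "finite P" and irrefl: "\<And>p. \<not> R p p"
    and total: "\<And>p q. p \<in> P \<Longrightarrow> q \<in> P \<Longrightarrow> p \<noteq> q \<Longrightarrow> R p q \<or> R q p"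
    and trans: "\<And>p q r. p \<in> P \<Longrightarrow> q \<in> P \<Longrightarrow> r \<in> P \<Longrightarrow> R p q \<Longrightarrow> R q r \<Longrightarrow> R p r"
  obtains \<kappa> :: "'a \<Rightarrow> nat" where "inj_on \<kappa> P" "\<kappa> ` P \<subseteq> {..<card P}"
    "\<And>p q. p \<in> P \<Longrightarrow> q \<in> P \<Longrightarrow> \<kappa> p < \<kappa> q \<longleftrightarrow> R p q"
proof -
  define \<kappa> where "\<kappa> p = card {x\<in>P. R x p}" for p
  have less: "\<kappa> p < \<kappa> q" if "p \<in> P" "q \<in> P" "R p q" for p q
  proof -
    have "{x\<in>P. R x p} \<subseteq> {x\<in>P. R x q}" using trans that by blast
    moreover have "p \<in> {x\<in>P. R x q}" "p \<notin> {x\<in>P. R x p}" using that irrefl by auto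
    ultimately have "{x\<in>P. R x p} \<subset> {x\<in>P. R x q}" by blast
    then show ?thesis unfolding \<kappa>_def using assms(1) by (intro psubset_card_mono) auto
  qed
  show thesis
  proof (rule that)
    show "inj_on \<kappa> P"
    proof (rule inj_onI, rule ccontr)
      fix p q assume "p \<in> P" "q \<in> P" "\<kappa> p = \<kappa> q" "p \<noteq> q"
      then show False using total[of p q] less[of p q] less[of q p] by auto
    qed
    show "\<kappa> ` P \<subseteq> {..<card P}"
    proof (rule image_subsetI)
      fix p assume "p \<in> P"
      then have "{x\<in>P. R x p} \<subset> P" using irrefl by blast
      then show "\<kappa> p \<in> {..<card P}" unfolding \<kappa>_def using assms(1) psubset_card_mono by auto
    qed
    show "\<kappa> p < \<kappa> q \<longleftrightarrow> R p q" if "p \<in> P" "q \<in> P" for p q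
      using less[OF that] less[OF that(2,1)] total[OF that] by (cases "p = q") auto
  qed
qed

text \<open>A line through two points of \<open>Q\<close> has all of \<open>P\<close> strictly on
  one side, so seen from \<open>q\<close> the set \<open>P\<close> lies within a half-plane and the
  order by angle is transitive. A line through two points of \<open>P\<close> has all of
  \<open>Q\<close> on one side, so every point of \<open>Q\<close> sees the same order.\<close>

lemma avoids_angular_rank:
  assumes "avoids P Q" "avoids Q P" "finite P" "card Q \<ge> 2"
  obtains \<kappa> :: "real^2 \<Rightarrow> nat" where "inj_on \<kappa> P" "\<kappa> ` P \<subseteq> {..<card P}"
    "\<And>p p' q. p \<in> P \<Longrightarrow> p' \<in> P \<Longrightarrow> q \<in> Q \<Longrightarrow> \<kappa> p < \<kappa> p' \<longleftrightarrow> orient p p' q > 0"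
proof -
  obtain q where "q \<in> Q" using card_ge_2_obtain[OF assms(4), of undefined] by blast
  moreover obtain w where "w \<in> Q" "w \<noteq> q" using card_ge_2_obtain[OF assms(4)] by blast
  ultimately have q: "q \<in> Q" "w \<in> Q" "q \<noteq> w" by auto
  let ?R = "\<lambda>p p'. orient p p' q > 0"
  have trans: "?R x z" if "x \<in> P" "y \<in> P" "z \<in> P" "?R x y" "?R y z" for x y z
  proof -
    have xy: "orient q x y > 0" "orient q y z > 0"
      using that(4,5) orient_cyclic[of q x y] orient_cyclic[of q y z] by simp_all
    have p: "orient q w y * orient q w x > 0" "orient q w y * orient q w z > 0"
      \<comment> \<open>Multiplying the Pluecker relation by \<open>orient q w y\<close> makes both
        of its terms positive, whichever side of the line \<open>qw\<close> contains
        \<open>P\<close>.\<close>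
      using avoids_same_side[OF assms(2) q] that(1-3) by blast+
    have "0 < (orient q w y * orient q w x) * orient q y z + (orient q w y * orient q w z) * orient q x y"
      by (rule add_pos_pos[OF mult_pos_pos[OF p(1) xy(2)] mult_pos_pos[OF p(2) xy(1)]])
    also have "\<dots> = orient q w y * (orient q w y * orient q x z)"
      unfolding orient_pluecker[of q w y x z] by (simp add: algebra_simps)
    also have "\<dots> = (orient q w y)\<^sup>2 * orient q x z" by (simp add: power2_eq_square)
    finally have "orient q x z > 0" by (simp add: zero_less_mult_iff)
    then show ?thesis using orient_cyclic[of q x z] by simp
  qed
  have total: "?R x y \<or> ?R y x" if "x \<in> P" "y \<in> P" "x \<noteq> y" for x y
    using avoids_orient_neq_0[OF assms(1) that q(1)] orient_swap[of y x q] by linarith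
  obtain \<kappa> :: "real^2 \<Rightarrow> nat" where \<kappa>: "inj_on \<kappa> P" "\<kappa> ` P \<subseteq> {..<card P}"
    "\<And>x y. x \<in> P \<Longrightarrow> y \<in> P \<Longrightarrow> \<kappa> x < \<kappa> y \<longleftrightarrow> ?R x y"
    by (rule strict_order_rank[where R = ?R, OF assms(3) _ total trans]) simp_all
  have "\<kappa> p < \<kappa> p' \<longleftrightarrow> orient p p' r > 0" if "p \<in> P" "p' \<in> P" "r \<in> Q" for p p' r
  proof (cases "p = p'")
    case False
    then show ?thesis
      using \<kappa>(3)[OF that(1,2)] avoids_same_side[OF assms(1) that(1,2) False q(1) that(3)]
      by (auto simp: zero_less_mult_iff)
  qed simp
  then show ?thesis using that \<kappa> by blast
qed

section \<open>Middle points of collinear triples\<close>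

lemma between_point:
  assumes "between (a, c) b" "b \<noteq> a" "b \<noteq> c"
  obtains u where "0 < u" "u < 1" "b = (1 - u) *\<^sub>R a + u *\<^sub>R c"
proof -
  obtain u where u: "0 \<le> u" "u \<le> 1" "b = (1 - u) *\<^sub>R a + u *\<^sub>R c"
    using assms(1) unfolding between_mem_segment closed_segment_def by auto
  then have "u \<noteq> 0" "u \<noteq> 1" using assms by auto
  then show ?thesis using that[of u] u by auto
qed

lemma orient_between_neg:
  assumes "between (a, c) b" "b \<noteq> a" "b \<noteq> c" "orient b x a \<noteq> 0"
  shows "orient b x a * orient b x c < 0"
proof -
  obtain u where u: "0 < u" "u < 1" "b = (1 - u) *\<^sub>R a + u *\<^sub>R c" using between_point[OF assms(1-3)] .
  have "(1 - u) * orient b x a + u * orient b x c = 0"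
    using orient_affine[of b x u a c] u(3) by simp
  then have eq: "u * orient b x c = - ((1 - u) * orient b x a)" by linarith
  have "u * (orient b x a * orient b x c) = orient b x a * (u * orient b x c)" by simp
  also have "\<dots> = - ((1 - u) * (orient b x a)\<^sup>2)" unfolding eq by (simp add: power2_eq_square)
  also have "\<dots> < 0" using u assms(4) by simp
  finally show ?thesis using u(1) by (simp add: mult_less_0_iff)
qed

lemma orient_between_pos:
  assumes "between (b, c) a" "a \<noteq> b" "a \<noteq> c" "orient b x a \<noteq> 0"
  shows "orient b x a * orient b x c > 0"
proof -
  obtain u where u: "0 < u" "u < 1" "a = (1 - u) *\<^sub>R b + u *\<^sub>R c" using between_point[OF assms(1-3)] .
  have eq: "orient b x a = u * orient b x c"
    unfolding u(3) by (simp add: orient_affine)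
  then have "orient b x c \<noteq> 0" using assms(4) by auto
  then show ?thesis unfolding eq using u(1) by (simp add: power2_eq_square[symmetric] mult.assoc)
qed

text \<open>For distinct \<open>b\<close> and \<open>x\<close> in \<open>B\<close> the line \<open>bx\<close> either separates \<open>A\<close> from \<open>C\<close> or has them on one
  side; it separates them exactly if \<open>b\<close> is the middle point of every triple through \<open>b\<close>.\<close>
lemma middle_class_unique:
  assumes av: "avoids B A" "avoids B C" and disj: "A \<inter> B = {}" "B \<inter> C = {}" "A \<inter> C = {}" and "card B \<ge> 2"
    and t: "(a, b, c) \<in> collinear_triples A B C" and t': "(a', b', c') \<in> collinear_triples A B C"
    and "between (a, c) b"
  shows "between (a', c') b'"
proof (rule ccontr)
  assume not: "\<not> between (a', c') b'"
  have mem: "a \<in> A" "b \<in> B" "c \<in> C" "a' \<in> A" "b' \<in> B" "c' \<in> C" "collinear {a', b', c'}"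
    using t t' by (auto simp: collinear_triples_def)
  have ne: "b \<noteq> a" "b \<noteq> c" "a' \<noteq> b'" "a' \<noteq> c'" "c' \<noteq> b'" using mem disj by auto
  obtain y where y: "y \<in> B" "y \<noteq> b" using card_ge_2_obtain[OF \<open>card B \<ge> 2\<close>] by blast
  \<comment> \<open>The lines \<open>bx\<close> and \<open>b'x'\<close> are made to coincide: for
    \<open>b' \<noteq> b\<close> both are the line \<open>bb'\<close>, otherwise both join
    \<open>b\<close> to the auxiliary point \<open>y\<close>.\<close>
  define x where "x = (if b' = b then y else b')"
  define x' where "x' = (if b' = b then y else b)"
  have x: "x \<in> B" "x \<noteq> b" and x': "x' \<in> B" "x' \<noteq> b'" using y mem by (auto simp: x_def x'_def)
  have "orient b x a * orient b x c < 0"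
    using orient_between_neg[OF assms(9) ne(1,2)] avoids_orient_neq_0[OF av(1) mem(2) x(1) _ mem(1)] x(2) by metis
  moreover have "orient b x a * orient b x a' > 0" "orient b x c * orient b x c' > 0"
    using avoids_same_side[OF av(1) mem(2) x(1) _ mem(1,4)] avoids_same_side[OF av(2) mem(2) x(1) _ mem(3,6)] x(2)
    by metis+
  ultimately have neg: "orient b x a' * orient b x c' < 0"
    by (auto simp: mult_less_0_iff zero_less_mult_iff)
  \<comment> \<open>Reversing the direction of the line changes both signs, so the product is
    unchanged.\<close>
  have eq: "orient b' x' a' * orient b' x' c' = orient b x a' * orient b x c'"
    using orient_swap[of b b'] by (auto simp: x_def x'_def)
  have nz: "orient b' x' a' \<noteq> 0" "orient b' x' c' \<noteq> 0"
    using avoids_orient_neq_0[OF av(1) mem(5) x'(1) _ mem(4)] avoids_orient_neq_0[OF av(2) mem(5) x'(1) _ mem(6)] x'(2)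
    by metis+
  have "between (b', c') a' \<or> between (c', a') b' \<or> between (a', b') c'"
    using mem(7) collinear_between_cases by blast
  then consider "between (b', c') a'" | "between (b', a') c'" using not by (auto simp: between_commute)
  then have "orient b' x' a' * orient b' x' c' > 0"
  proof cases
    case 1
    then show ?thesis using orient_between_pos[of b' c' a' x'] ne nz by blast
  next
    case 2
    then show ?thesis using orient_between_pos[of b' a' c' x'] ne nz by (metis mult.commute)
  qed
  then show False using neg eq by linarith
qed

lemma linear_collinear_triples:
  assumes "mutually_avoiding A B C" and disj: "A \<inter> B = {}" "B \<inter> C = {}" "A \<inter> C = {}"
  shows "linear_triples (collinear_triples A B C)"
  unfolding linear_triples_def
proof (intro allI impI)
  fix a b c a' b' c'
  assume t: "(a, b, c) \<in> collinear_triples A B C" and t': "(a', b', c') \<in> collinear_triples A B C"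
  have mem: "a \<in> A" "b \<in> B" "c \<in> C" "a' \<in> A" "b' \<in> B" "c' \<in> C" and col: "collinear {a, b, c}" "collinear {a', b', c'}"
    using t t' by (auto simp: collinear_triples_def)
  have ne: "a \<noteq> b" "b \<noteq> c" "c \<noteq> a" using mem disj by auto
  have av: "avoids C A" "avoids B A" "avoids A B" using assms(1) by (auto simp: mutually_avoiding_def)
  have "c = c'" if "a = a'" "b = b'"
    using avoids_collinear_unique[OF av(1) mem(3,6,1) ne(1) col(1)] col(2) that by simp
  moreover have "b = b'" if "a = a'" "c = c'"
    using avoids_collinear_unique[OF av(2) mem(2,5,1) ne(3)[symmetric]] col that by (simp add: insert_commute)
  moreover have "a = a'" if "b = b'" "c = c'"
    using avoids_collinear_unique[OF av(3) mem(1,4,2) ne(2)] col that by (simp add: insert_commute)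
  ultimately show "(a = a' \<and> b = b' \<longrightarrow> c = c') \<and> (a = a' \<and> c = c' \<longrightarrow> b = b') \<and> (b = b' \<and> c = c' \<longrightarrow> a = a')"
    by blast
qed

text \<open>The hypotheses put \<open>a'\<close> and \<open>b'\<close> on opposite sides of the line
  \<open>abc\<close>. As \<open>b'\<close> lies between \<open>a'\<close> and \<open>c'\<close>, the
  point \<open>c'\<close> lies on the side of \<open>b'\<close>, which is the claim about the order
  of \<open>c'\<close> and \<open>c\<close> as seen from \<open>b\<close>.\<close>

lemma orient_middle_monotone:
  assumes "between (a, c) b" "b \<noteq> a" "b \<noteq> c" "between (a', c') b'" "b' \<noteq> a'" "b' \<noteq> c'"
    and "orient a' a b > 0" "orient b' b a > 0"
  shows "orient c' c b > 0"
proof -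
  obtain u where u: "0 < u" "u < 1" "b = (1 - u) *\<^sub>R a + u *\<^sub>R c" using between_point[OF assms(1-3)] .
  obtain v where v: "0 < v" "v < 1" "b' = (1 - v) *\<^sub>R a' + v *\<^sub>R c'" using between_point[OF assms(4-6)] .
  have "orient a b a' > 0" using assms(7) orient_cyclic[of a' a b] by simp
  moreover have b': "orient a b b' < 0" using assms(8) orient_cyclic[of b' b a] orient_swap[of a b b'] by simp
  moreover have "orient a b b' = (1 - v) * orient a b a' + v * orient a b c'"
    unfolding v(3) by (rule orient_affine)
  moreover have "(1 - v) * orient a b a' > 0" using v \<open>orient a b a' > 0\<close> by simp
  ultimately have "v * orient a b c' < 0" by linarith
  then have neg: "orient a b c' < 0" using v by (simp add: mult_less_0_iff)
  have "u * orient b c c' = (1 - u) * orient a b c'"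
    unfolding u(3) by (simp add: orient_def algebra_simps)
  also have "\<dots> < 0" using neg u by (simp add: mult_less_0_iff)
  finally have "orient b c c' < 0" using u by (simp add: mult_less_0_iff)
  then show ?thesis using orient_cyclic[of c' c b] orient_cyclic[of c b c'] orient_swap[of c b c'] by simp
qed

section \<open>From grids of ranks to tic-tac-toes of points\<close>

lemma contains_grid_imp_tic_tac_toe:
  assumes "contains_grid (collinear_triples A B C)" and disj: "A \<inter> B = {}" "B \<inter> C = {}" "A \<inter> C = {}"
  shows "\<exists>E \<subseteq> triple_hypergraph A B C. tic_tac_toe E"
proof -
  obtain a1 a2 a3 b1 b2 b3 c1 c2 c3 where dist: "distinct [a1, a2, a3]" "distinct [b1, b2, b3]" "distinct [c1, c2, c3]"
    and T: "{(a1, b1, c1), (a2, b2, c2), (a3, b3, c3), (a3, b1, c2), (a2, b3, c1), (a1, b2, c3)} \<subseteq> collinear_triples A B C"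
    using assms(1) by (rule contains_gridE)
  \<comment> \<open>The classes are arranged as a Latin square, so that each row and each column of
    the board has one point of each class. Board indices start at 1, list positions at 0.\<close>
  define x where "x i j = [[b1, c1, a1], [c2, a2, b2], [a3, b3, c3]] ! (i - 1) ! (j - 1)" for i j :: nat
  have three: "{1..3} = {1, 2, 3 :: nat}" by auto
  have vals: "x 1 1 = b1" "x 1 2 = c1" "x 1 3 = a1" "x 2 1 = c2" "x 2 2 = a2" "x 2 3 = b2"
    "x 3 1 = a3" "x 3 2 = b3" "x 3 3 = c3"
    by (simp_all add: x_def eval_nat_numeral)
  define E where "E = (\<lambda>i. {x i 1, x i 2, x i 3}) ` {1..3} \<union> (\<lambda>j. {x 1 j, x 2 j, x 3 j}) ` {1..3}"
  have E: "E = {{b1, c1, a1}, {c2, a2, b2}, {a3, b3, c3}} \<union> {{b1, c2, a3}, {c1, a2, b3}, {a1, b2, c3}}"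
    unfolding E_def three by (simp only: image_insert image_empty vals)
  have edge: "{a, b, c} \<in> triple_hypergraph A B C" if "(a, b, c) \<in> collinear_triples A B C" for a b c
    unfolding triple_hypergraph_def using that by (rule rev_image_eqI) simp
  have "{a1, b1, c1} \<in> triple_hypergraph A B C" "{a2, b2, c2} \<in> triple_hypergraph A B C"
    "{a3, b3, c3} \<in> triple_hypergraph A B C" "{a3, b1, c2} \<in> triple_hypergraph A B C"
    "{a2, b3, c1} \<in> triple_hypergraph A B C" "{a1, b2, c3} \<in> triple_hypergraph A B C"
    using T by (auto intro!: edge)
  moreover have "{b1, c1, a1} = {a1, b1, c1}" "{c2, a2, b2} = {a2, b2, c2}" "{b1, c2, a3} = {a3, b1, c2}"
    "{c1, a2, b3} = {a2, b3, c1}" by blast+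
  ultimately have "E \<subseteq> triple_hypergraph A B C" unfolding E by simp
  moreover have "inj_on (\<lambda>(i, j). x i j) ({1..3} \<times> {1..3})"
  proof -
    \<comment> \<open>The board positions in the order of the vertices by class; injectivity on the
      board becomes distinctness of the list of nine points.\<close>
    let ?ix = "[(1, 3), (2, 2), (3, 1), (1, 1), (2, 3), (3, 2), (1, 2), (2, 1), (3, 3)] :: (nat \<times> nat) list"
    have "set [a1, a2, a3] \<subseteq> A" "set [b1, b2, b3] \<subseteq> B" "set [c1, c2, c3] \<subseteq> C"
      using T by (auto simp: collinear_triples_def)
    then have "distinct ([a1, a2, a3] @ [b1, b2, b3] @ [c1, c2, c3])"
      unfolding distinct_append set_append using dist disj by blast
    moreover have "map (\<lambda>(i, j). x i j) ?ix = [a1, a2, a3] @ [b1, b2, b3] @ [c1, c2, c3]"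
      by (simp only: list.map prod.case vals append.simps)
    ultimately have "distinct (map (\<lambda>(i, j). x i j) ?ix)" by (simp only:)
    then have "inj_on (\<lambda>(i, j). x i j) (set ?ix)" unfolding distinct_map by blast
    moreover have "{1..3} \<times> {1..3} = set ?ix" unfolding three by auto
    ultimately show ?thesis by (simp only:)
  qed
  ultimately show ?thesis unfolding tic_tac_toe_def E_def by blast
qed

text \<open>Each coordinate map is inverted separately, so a vertex shared by two triples has the
  same preimage in both and the pattern is kept.\<close>

lemma contains_grid_image:
  assumes "contains_grid ((\<lambda>(a, b, c). (f a, g b, h c)) ` T)" "T \<subseteq> A \<times> B \<times> C"
    and inj: "inj_on f A" "inj_on g B" "inj_on h C"
  shows "contains_grid T"
proof -
  let ?F = "\<lambda>(a, b, c). (f a, g b, h c)"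
  let ?f = "inv_into A f" and ?g = "inv_into B g" and ?h = "inv_into C h"
  obtain a1 a2 a3 b1 b2 b3 c1 c2 c3 where dist: "distinct [a1, a2, a3]" "distinct [b1, b2, b3]" "distinct [c1, c2, c3]"
    and T: "{(a1, b1, c1), (a2, b2, c2), (a3, b3, c3), (a3, b1, c2), (a2, b3, c1), (a1, b2, c3)} \<subseteq> ?F ` T"
    using assms(1) by (rule contains_gridE)
  have preimage: "(?f a, ?g b, ?h c) \<in> T \<and> f (?f a) = a \<and> g (?g b) = b \<and> h (?h c) = c" if mem: "(a, b, c) \<in> ?F ` T" for a b c
  proof -
    obtain a' b' c' where t: "(a', b', c') \<in> T" and eq: "a = f a'" "b = g b'" "c = h c'" using mem by auto
    then have "a' \<in> A" "b' \<in> B" "c' \<in> C" using assms(2) by auto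
    then show ?thesis using t inj by (simp add: eq)
  qed
  have sub: "{(?f a1, ?g b1, ?h c1), (?f a2, ?g b2, ?h c2), (?f a3, ?g b3, ?h c3), (?f a3, ?g b1, ?h c2),
      (?f a2, ?g b3, ?h c1), (?f a1, ?g b2, ?h c3)} \<subseteq> T"
    using preimage T by (simp only: insert_subset) blast
  have "f (?f a1) = a1" "f (?f a2) = a2" "f (?f a3) = a3" "g (?g b1) = b1" "g (?g b2) = b2" "g (?g b3) = b3"
    "h (?h c1) = c1" "h (?h c2) = c2" "h (?h c3) = c3"
    using preimage[of a1 b1 c1] preimage[of a2 b2 c2] preimage[of a3 b3 c3] T by (simp_all only: insert_subset)
  then have "distinct (map f [?f a1, ?f a2, ?f a3])" "distinct (map g [?g b1, ?g b2, ?g b3])"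
      "distinct (map h [?h c1, ?h c2, ?h c3])"
    using dist by (simp_all only: list.map)
  then show ?thesis unfolding distinct_map using sub by (blast intro: contains_gridI)
qed

lemma linear_triples_image:
  assumes "linear_triples T" "T \<subseteq> A \<times> B \<times> C" "inj_on f A" "inj_on g B" "inj_on h C"
  shows "linear_triples ((\<lambda>(a, b, c). (f a, g b, h c)) ` T)" (is "linear_triples (?F ` T)")
  unfolding linear_triples_def
proof (intro allI impI)
  fix x y z x' y' z' assume "(x, y, z) \<in> ?F ` T" "(x', y', z') \<in> ?F ` T"
  then obtain a b c a' b' c' where t: "(a, b, c) \<in> T" "(a', b', c') \<in> T"
    and eq: "x = f a" "y = g b" "z = h c" "x' = f a'" "y' = g b'" "z' = h c'" by auto
  have "a \<in> A" "b \<in> B" "c \<in> C" "a' \<in> A" "b' \<in> B" "c' \<in> C" using t assms(2) by auto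
  then have iff: "f a = f a' \<longleftrightarrow> a = a'" "g b = g b' \<longleftrightarrow> b = b'" "h c = h c' \<longleftrightarrow> c = c'"
    using inj_on_eq_iff[OF assms(3)] inj_on_eq_iff[OF assms(4)] inj_on_eq_iff[OF assms(5)] by blast+
  show "(x = x' \<and> y = y' \<longrightarrow> z = z') \<and> (x = x' \<and> z = z' \<longrightarrow> y = y') \<and> (y = y' \<and> z = z' \<longrightarrow> x = x')"
    unfolding eq iff using linear_triplesD[OF assms(1) t] by blast
qed

lemma mutually_avoiding_disjoint:
  assumes "mutually_avoiding A B C" "card A \<ge> 2" "card B \<ge> 2"
  shows "A \<inter> B = {}" "B \<inter> C = {}" "A \<inter> C = {}"
  using assms avoids_disjoint[of A B] avoids_disjoint[of B C] avoids_disjoint[of A C]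
  by (auto simp: mutually_avoiding_def)

text \<open>The outer classes \<open>A\<close> and \<open>C\<close> are ranked as seen from the
  middle class \<open>B\<close>, and \<open>B\<close> as seen from \<open>A\<close>. For these
  orders \<open>orient_middle_monotone\<close> is exactly the monotonicity of the triples of
  ranks.\<close>

lemma tic_tac_toe_if_middle:
  assumes grid: "\<forall>T \<subseteq> {..<n} \<times> {..<n} \<times> {..<n}. linear_triples T \<and> monotone_triples T \<and>
      real (card T) \<ge> \<delta> * (real n)\<^sup>2 \<longrightarrow> contains_grid T"
    and av: "mutually_avoiding A B C" and n: "card A = n" "card B = n" "card C = n" "n \<ge> 2"
    and card: "real (card (collinear_triples A B C)) \<ge> \<delta> * (real n)\<^sup>2"
    and mid: "\<And>a b c. (a, b, c) \<in> collinear_triples A B C \<Longrightarrow> between (a, c) b"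
  shows "\<exists>E \<subseteq> triple_hypergraph A B C. tic_tac_toe E"
proof -
  note disj = mutually_avoiding_disjoint[OF av, unfolded n, OF n(4) n(4)]
  let ?T = "collinear_triples A B C"
  have sub: "?T \<subseteq> A \<times> B \<times> C" by (auto simp: collinear_triples_def)
  note av' = av[unfolded mutually_avoiding_def]
  obtain f :: "real^2 \<Rightarrow> nat" where f: "inj_on f A" "f ` A \<subseteq> {..<n}"
    "\<And>a a' b. a \<in> A \<Longrightarrow> a' \<in> A \<Longrightarrow> b \<in> B \<Longrightarrow> f a < f a' \<longleftrightarrow> orient a a' b > 0"
    by (rule avoids_angular_rank[of A B]) (use av' n in auto)
  obtain g :: "real^2 \<Rightarrow> nat" where g: "inj_on g B" "g ` B \<subseteq> {..<n}"
    "\<And>b b' a. b \<in> B \<Longrightarrow> b' \<in> B \<Longrightarrow> a \<in> A \<Longrightarrow> g b < g b' \<longleftrightarrow> orient b b' a > 0"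
    by (rule avoids_angular_rank[of B A]) (use av' n in auto)
  obtain h :: "real^2 \<Rightarrow> nat" where h: "inj_on h C" "h ` C \<subseteq> {..<n}"
    "\<And>c c' b. c \<in> C \<Longrightarrow> c' \<in> C \<Longrightarrow> b \<in> B \<Longrightarrow> h c < h c' \<longleftrightarrow> orient c c' b > 0"
    by (rule avoids_angular_rank[of C B]) (use av' n in auto)
  let ?F = "\<lambda>(a, b, c). (f a, g b, h c)"
  have "inj_on ?F ?T"
    by (rule inj_on_subset[OF _ sub]) (use f(1) g(1) h(1) in \<open>auto simp: inj_on_def\<close>)
  then have cardF: "card (?F ` ?T) = card ?T" by (rule card_image)
  have "contains_grid (?F ` ?T)"
  proof (intro grid[rule_format] conjI)
    have "?F ` ?T \<subseteq> ?F ` (A \<times> B \<times> C)" using sub by (rule image_mono)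
    also have "\<dots> \<subseteq> f ` A \<times> g ` B \<times> h ` C" by auto
    also have "\<dots> \<subseteq> {..<n} \<times> {..<n} \<times> {..<n}" using f(2) g(2) h(2) by (intro Sigma_mono)
    finally show "?F ` ?T \<subseteq> {..<n} \<times> {..<n} \<times> {..<n}" .
    show "linear_triples (?F ` ?T)"
      by (rule linear_triples_image[OF linear_collinear_triples[OF av disj] sub f(1) g(1) h(1)])
    show "real (card (?F ` ?T)) \<ge> \<delta> * (real n)\<^sup>2" using card cardF by simp
    have less: "h c' < h c" if t: "(a, b, c) \<in> ?T" "(a', b', c') \<in> ?T" and lt: "f a' < f a" "g b' < g b" for a b c a' b' c'
    proof -
      have mem: "a \<in> A" "b \<in> B" "c \<in> C" "a' \<in> A" "b' \<in> B" "c' \<in> C" using t sub by auto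
      then have ne: "b \<noteq> a" "b \<noteq> c" "b' \<noteq> a'" "b' \<noteq> c'" using disj by auto
      have "orient c' c b > 0"
        using orient_middle_monotone[OF mid[OF t(1)] ne(1,2) mid[OF t(2)] ne(3,4)] lt
          f(3)[OF mem(4,1,2)] g(3)[OF mem(5,2,1)] by simp
      then show ?thesis using h(3)[OF mem(6,3,2)] by simp
    qed
    show "monotone_triples (?F ` ?T)"
      unfolding monotone_triples_def
    proof (intro allI impI)
      fix x y z x' y' z' assume "(x, y, z) \<in> ?F ` ?T" "(x', y', z') \<in> ?F ` ?T" and xy: "x < x'" "y < y'"
      then obtain a b c a' b' c' where t: "(a, b, c) \<in> ?T" "(a', b', c') \<in> ?T"
        and eq: "x = f a" "y = g b" "z = h c" "x' = f a'" "y' = g b'" "z' = h c'" by auto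
      then show "z \<le> z'" using less[OF t(2,1)] xy by simp
    qed
  qed
  then show ?thesis
    by (intro contains_grid_imp_tic_tac_toe[OF contains_grid_image[OF _ sub f(1) g(1) h(1)] disj])
qed

section \<open>Cyclic symmetry of the classes and the conclusion\<close>

lemma card_collinear_triples_rotate: "card (collinear_triples B C A) = card (collinear_triples A B C)"
proof (rule bij_betw_same_card)
  show "bij_betw (\<lambda>(b, c, a). (a, b, c)) (collinear_triples B C A) (collinear_triples A B C)"
    by (rule bij_betw_byWitness[where f' = "\<lambda>(a, b, c). (b, c, a)"])
      (auto simp: collinear_triples_def insert_commute)
qed

lemma mutually_avoiding_rotate: "mutually_avoiding A B C \<Longrightarrow> mutually_avoiding B C A"
  by (auto simp: mutually_avoiding_def)

lemma collinear_triples_rotate: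
  "(b, c, a) \<in> collinear_triples B C A \<longleftrightarrow> (a, b, c) \<in> collinear_triples A B C"
  by (auto simp: collinear_triples_def insert_commute)

lemma triple_hypergraph_rotate: "triple_hypergraph B C A = triple_hypergraph A B C"
proof -
  have sub: "triple_hypergraph X Y Z \<subseteq> triple_hypergraph Y Z X" for X Y Z
  proof
    fix e assume "e \<in> triple_hypergraph X Y Z"
    then obtain x y z where "(x, y, z) \<in> collinear_triples X Y Z" "e = {x, y, z}"
      unfolding triple_hypergraph_def by auto
    then have "(y, z, x) \<in> collinear_triples Y Z X" "e = {y, z, x}"
      unfolding collinear_triples_rotate[of y z x] by auto
    then show "e \<in> triple_hypergraph Y Z X"
      unfolding triple_hypergraph_def by (intro rev_image_eqI) auto
  qed
  show ?thesis using sub[of A B C] sub[of B C A] sub[of C A B] by blast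
qed

lemma tic_tac_toe_if_triple_middle:
  assumes grid: "\<forall>T \<subseteq> {..<n} \<times> {..<n} \<times> {..<n}. linear_triples T \<and> monotone_triples T \<and>
      real (card T) \<ge> \<delta> * (real n)\<^sup>2 \<longrightarrow> contains_grid T"
    and av: "mutually_avoiding A B C" and n: "card A = n" "card B = n" "card C = n" "n \<ge> 2"
    and card: "real (card (collinear_triples A B C)) \<ge> \<delta> * (real n)\<^sup>2"
    and t: "(a, b, c) \<in> collinear_triples A B C" "between (a, c) b"
  shows "\<exists>E \<subseteq> triple_hypergraph A B C. tic_tac_toe E"
proof (rule tic_tac_toe_if_middle[OF grid av n card])
  note disj = mutually_avoiding_disjoint[OF av, unfolded n, OF n(4) n(4)]
  show "between (a', c') b'" if "(a', b', c') \<in> collinear_triples A B C" for a' b' c'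
    using middle_class_unique[OF _ _ disj _ t(1) that t(2)] av n by (simp add: mutually_avoiding_def)
qed

theorem theorem2p1:
  fixes \<delta> :: real
  assumes "\<delta> > 0"
  shows "\<exists>n0 :: nat. \<forall>n \<ge> n0. \<forall>A B C :: (real^2) set.
           mutually_avoiding A B C \<and> card A = n \<and> card B = n \<and> card C = n \<and>
           real (card (collinear_triples A B C)) \<ge> \<delta> * (real n)\<^sup>2
           \<longrightarrow> (\<exists>E \<subseteq> triple_hypergraph A B C. tic_tac_toe E)"
proof -
  obtain n0 where n0: "\<And>n T. \<lbrakk>n \<ge> n0; T \<subseteq> {..<n} \<times> {..<n} \<times> {..<n}; linear_triples T; monotone_triples T;
      card T \<ge> \<delta> * (real n)\<^sup>2\<rbrakk> \<Longrightarrow> contains_grid T"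
    using monotone_triples_contain_grid[OF assms] by blast
  show ?thesis
  \<comment> \<open>Two points in each class make the classes disjoint and provide the lines used
    for the angular orders.\<close>
  proof (intro exI[of _ "max n0 2"] allI impI, elim conjE)
    fix n and A B C :: "(real^2) set"
    assume "n \<ge> max n0 2" and av: "mutually_avoiding A B C" and n: "card A = n" "card B = n" "card C = n"
      and card: "real (card (collinear_triples A B C)) \<ge> \<delta> * (real n)\<^sup>2"
    then have n': "n \<ge> n0" "n \<ge> 2" by auto
    then have "\<delta> * (real n)\<^sup>2 > 0" using assms by simp
    then have "collinear_triples A B C \<noteq> {}" using card by auto
    then obtain a b c where t: "(a, b, c) \<in> collinear_triples A B C" by auto
    note av1 = mutually_avoiding_rotate[OF av]
    note av2 = mutually_avoiding_rotate[OF av1]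
    have "\<forall>T \<subseteq> {..<n} \<times> {..<n} \<times> {..<n}. linear_triples T \<and> monotone_triples T \<and>
      real (card T) \<ge> \<delta> * (real n)\<^sup>2 \<longrightarrow> contains_grid T"
      using n0[OF n'(1)] by simp
    note main = tic_tac_toe_if_triple_middle[OF this]
    have "collinear {a, b, c}" using t by (simp add: collinear_triples_def)
    \<comment> \<open>The middle point of one triple decides which class is in the middle for all;
      rotating the classes makes it the second one.\<close>
    then consider "between (b, c) a" | "between (c, a) b" | "between (a, b) c"
      using collinear_between_cases by blast
    then show "\<exists>E \<subseteq> triple_hypergraph A B C. tic_tac_toe E"
    proof cases
      case 1
      have "(c, a, b) \<in> collinear_triples C A B" using t by (simp only: collinear_triples_rotate[of a b])
      moreover have "real (card (collinear_triples C A B)) \<ge> \<delta> * (real n)\<^sup>2"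
        using card by (simp add: card_collinear_triples_rotate[of A B C])
      ultimately have "\<exists>E \<subseteq> triple_hypergraph C A B. tic_tac_toe E"
        using main[OF av2 n(3,1,2) n'(2)] 1 by (simp add: between_commute)
      then show ?thesis by (simp only: triple_hypergraph_rotate[of A B C])
    next
      case 2
      then show ?thesis using main[OF av n n'(2) card t] by (simp add: between_commute)
    next
      case 3
      have "(b, c, a) \<in> collinear_triples B C A" using t by (simp only: collinear_triples_rotate[of b c])
      moreover have "real (card (collinear_triples B C A)) \<ge> \<delta> * (real n)\<^sup>2"
        using card by (simp add: card_collinear_triples_rotate[of B C A])
      ultimately have "\<exists>E \<subseteq> triple_hypergraph B C A. tic_tac_toe E"
        using main[OF av1 n(2,3,1) n'(2)] 3 by (simp add: between_commute)
      then show ?thesis by (simp only: triple_hypergraph_rotate[of B C A])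
    qed
  qed
qed

end
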